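(* For $\varepsilon=(\varepsilon_1,\varepsilon_2)\in(\mathbb D\setminus\{0\})^2$ let $\ell_\varepsilon$ denote the Lempert function of the bidisk $\mathbb D^2$ with respect to the three poles $a_0=(0,0)$, $a_1=(\varepsilon_1,0)$, $a_2=(0,\varepsilon_2)$. Below, $E$ denotes a subset of $(\mathbb D\setminus\{0\})^2$ having $(0,0)$ as an accumulation point, and all limits, for fixed $z$, are taken as $\varepsilon\to(0,0)$ with $\varepsilon\in E$. (1) There exists a constant $C>0$ such that, for every $z=(z_1,z_2)\in\mathbb D^2$ and every such $E$, if $z_1=0$, or $z_2=0$, or if $z_1\ne0$, $z_2\ne0$ and $\lim_{\varepsilon\to0,\ \varepsilon\in E}\frac{\varepsilon_1}{\varepsilon_2}=-\frac{z_1}{z_2}$, then $$\limsup_{\varepsilon\to0,\ \varepsilon\in E}\ell_\varepsilon(z)\le2\log|z|+C.$$ (2) For any $c_0>0$ there exists a constant $C=C(c_0)>0$ such that, for any $z=(z_1,z_2)\in\mathbb D^2$ with $z_1\neq 0$, $z_2\ne0$ and $c_0\le\left|\frac{z_1}{z_2}\right|\le c_0^{-1}$, and any such $E$ all of whose elements $(\varepsilon_1,\varepsilon_2)$ satisfy $$\left|\frac{z_1}{|z_1|}\frac{|z_2|}{z_2}+\frac{\varepsilon_1}{|\varepsilon_1|}\frac{|\varepsilon_2|}{\varepsilon_2}\right|\ge c_0,$$ one has $$\liminf_{\varepsilon\to0,\ \varepsilon\in E}\ell_\varepsilon(z)\ge\frac32\log|z|-C.$$ If, furthermore, $$\lim_{\varepsilon\to0,\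 \varepsilon\in E}\frac{\varepsilon_1^2}{\varepsilon_2}=\lim_{\varepsilon\to0,\ \varepsilon\in E}\frac{\varepsilon_2^2}{\varepsilon_1}=0,$$ then $$\limsup_{\varepsilon\to0,\ \varepsilon\in E}\ell_\varepsilon(z)\le\frac32\log|z|+C.$$
   Context: $\mathbb D$ is the open unit disc in $\mathbb C$. For $z=(z_1,z_2)\in\mathbb C^2$, $|z|:=\max(|z_1|,|z_2|)$, and $\log0=-\infty$. For a domain $\Omega\subset\mathbb C^n$ and poles $a_0,\dots,a_N\in\Omega$, the (Coman) Lempert function is $$\ell_{a_0,\dots,a_N}(z):=\inf\Big\{\sum_{j=0}^N\log|\zeta_j| : \zeta_j\in\mathbb D,\ \varphi(0)=z,\ \varphi(\zeta_j)=a_j,\ j=0,\dots,N,\ \text{for some holomorphic }\varphi:\mathbb D\to\Omega\Big\}.$$ *)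

theory Defs
  imports "HOL-Complex_Analysis.Complex_Analysis"
begin

text \<open>Logarithm of a nonnegative real with the convention that the logarithm of \<open>0\<close> is
  \<open>-\<infinity>\<close>; the library's real-valued \<^const>\<open>ln\<close> has \<open>ln 0 = 0\<close>.\<close>

definition elog :: "real \<Rightarrow> ereal" where
  "elog x = (if x = 0 then -\<infinity> else ereal (ln x))"

abbreviation unit_disc :: "complex set" where
  "unit_disc \<equiv> ball 0 1"

text \<open>Prefix projections: the infix \<open>$\<close> is ambiguous here, being also the coefficient
  notation for formal power series.\<close>

abbreviation pr1 :: "complex ^ 2 \<Rightarrow> complex" where
  "pr1 z \<equiv> vec_nth z 1"

abbreviation pr2 :: "complex ^ 2 \<Rightarrow> complex" where
  "pr2 z \<equiv> vec_nth z 2"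

definition holomorphic_disc :: "(complex ^ 'n) set \<Rightarrow> (complex \<Rightarrow> complex ^ 'n) \<Rightarrow> bool" where
  "holomorphic_disc \<Omega> \<phi> \<longleftrightarrow>
     (\<forall>i. (\<lambda>w. vec_nth (\<phi> w) i) holomorphic_on unit_disc) \<and> \<phi> ` unit_disc \<subseteq> \<Omega>"

text \<open>The poles are \<open>a 0, \<dots>, a N\<close>; values of \<open>a\<close> at larger indices are irrelevant.  No summand
  is \<open>+\<infinity>\<close>, so the sum in \<^typ>\<open>ereal\<close> is the usual one (and it is \<open>-\<infinity>\<close> as soon as one
  \<open>\<zeta> j\<close> vanishes).\<close>

definition lempert ::
  "(complex ^ 'n) set \<Rightarrow> nat \<Rightarrow> (nat \<Rightarrow> complex ^ 'n) \<Rightarrow> complex ^ 'n \<Rightarrow> ereal" where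
  "lempert \<Omega> N a z =
     Inf {(\<Sum>j\<le>N. elog (cmod (\<zeta> j))) | \<zeta>.
            (\<forall>j\<le>N. \<zeta> j \<in> unit_disc) \<and>
            (\<exists>\<phi>. holomorphic_disc \<Omega> \<phi> \<and> \<phi> 0 = z \<and> (\<forall>j\<le>N. \<phi> (\<zeta> j) = a j))}"

definition bidisc :: "(complex ^ 2) set" where
  "bidisc = {z. pr1 z \<in> unit_disc \<and> pr2 z \<in> unit_disc}"

definition punctured_disc_sq :: "(complex ^ 2) set" where
  "punctured_disc_sq = {z. pr1 z \<in> unit_disc - {0} \<and> pr2 z \<in> unit_disc - {0}}"

text \<open>The norm of the type \<^typ>\<open>complex ^ 2\<close> is the Euclidean one, hence a separate maximum norm.\<close>

definition max_norm :: "complex ^ 2 \<Rightarrow> real" where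
  "max_norm z = max (cmod (pr1 z)) (cmod (pr2 z))"

definition lempert_bidisc :: "complex ^ 2 \<Rightarrow> complex ^ 2 \<Rightarrow> ereal" where
  "lempert_bidisc \<epsilon> z =
     lempert bidisc 2 (\<lambda>j. [0, vector [pr1 \<epsilon>, 0], vector [0, pr2 \<epsilon>]] ! j) z"

end

theory Submission
  imports Defs
begin

text \<open>
  A disc through the three poles has components \<open>f = b\<^sub>0 b\<^sub>2 h\<^sub>1\<close> and \<open>g = b\<^sub>0 b\<^sub>1 h\<^sub>2\<close>, where \<open>b\<^sub>j\<close> is the
  Blaschke factor with zero \<open>\<zeta>\<^sub>j\<close> and \<open>h\<^sub>1\<close>, \<open>h\<^sub>2\<close> are bounded by \<open>1\<close> (\<open>blaschke_division2\<close>). Each \<open>h\<^sub>i\<close> has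
  exactly two prescribed values: \<open>h\<^sub>1 0 = z\<^sub>1 / (\<zeta>\<^sub>0 \<zeta>\<^sub>2)\<close> and \<open>h\<^sub>1 \<zeta>\<^sub>1 = \<epsilon>\<^sub>1 / (b\<^sub>0 \<zeta>\<^sub>1 \<cdot> b\<^sub>2 \<zeta>\<^sub>1)\<close>,
  and symmetrically \<open>h\<^sub>2 0 = z\<^sub>2 / (\<zeta>\<^sub>0 \<zeta>\<^sub>1)\<close> and \<open>h\<^sub>2 \<zeta>\<^sub>2 = \<epsilon>\<^sub>2 / (b\<^sub>0 \<zeta>\<^sub>2 \<cdot> b\<^sub>1 \<zeta>\<^sub>2)\<close>. The theorem
  asks how small \<open>\<bar>\<zeta>\<^sub>0 \<zeta>\<^sub>1 \<zeta>\<^sub>2\<bar>\<close> can be for these values to be compatible.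

  Upper bounds. If the two values of each \<open>h\<^sub>i\<close> tend to a common limit in the open disc as the poles
  merge, affine functions \<open>h\<^sub>i\<close> interpolate them (\<open>Limsup_lempert_bidisc_le\<close>). It remains to choose
  nodes. On a coordinate axis, one node stays far from \<open>0\<close> and the two others merge at a point of
  size \<open>\<bar>z\<bar>\<close>. If \<open>\<epsilon>\<^sub>1 / \<epsilon>\<^sub>2\<close> tends to \<open>-z\<^sub>1 / z\<^sub>2\<close>, then \<open>\<zeta>\<^sub>0\<close> can stay far from \<open>0\<close> and
  \<open>\<zeta>\<^sub>1\<close>, \<open>\<zeta>\<^sub>2\<close> merge at a point of size \<open>\<bar>z\<bar>\<close>. Both give \<open>\<bar>\<zeta>\<^sub>0 \<zeta>\<^sub>1 \<zeta>\<^sub>2\<bar>\<close> of order \<open>\<bar>z\<bar>\<^sup>2\<close>. In the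
  transversal case all three nodes merge at a point of size \<open>\<bar>z\<bar>\<^bsup>1/2\<^esup>\<close>, which gives order
  \<open>\<bar>z\<bar>\<^bsup>3/2\<^esup>\<close> (\<open>Limsup_lempert_bidisc_transversal\<close>).

  Lower bound. If \<open>\<bar>\<zeta>\<^sub>0 \<zeta>\<^sub>1 \<zeta>\<^sub>2\<bar>\<close> is much smaller than \<open>\<bar>z\<bar>\<^bsup>3/2\<^esup>\<close>, then \<open>\<zeta>\<^sub>1\<close> and \<open>\<zeta>\<^sub>2\<close> are so small
  that \<open>h\<^sub>1\<close> and \<open>h\<^sub>2\<close> are nearly constant between \<open>0\<close> and the node, by the Schwarz lemma, and \<open>b\<^sub>0\<close>
  takes nearly the same value at \<open>\<zeta>\<^sub>1\<close> and \<open>\<zeta>\<^sub>2\<close>. Small \<open>\<epsilon>\<close> makes \<open>\<zeta>\<^sub>1 / \<zeta>\<^sub>2\<close> close to \<open>1\<close>. The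
  formulas for the prescribed values then give \<open>\<epsilon>\<^sub>1 / \<epsilon>\<^sub>2 \<approx> - z\<^sub>1 / z\<^sub>2\<close> (\<open>ratio_near_minus_1\<close>),
  contrary to the assumption on the arguments.
\<close>

section \<open>Blaschke factors\<close>

abbreviation blaschke :: "complex \<Rightarrow> complex \<Rightarrow> complex" where
  "blaschke a \<equiv> Moebius_function 0 a"

lemma one_minus_cnj_mult_nonzero:
  fixes a z :: complex
  assumes "cmod a < 1" "cmod z < 1"
  shows "1 - cnj a * z \<noteq> 0"
proof
  assume "1 - cnj a * z = 0"
  then have "cmod a * cmod z = 1"
    by (metis complex_mod_cnj norm_mult norm_one right_minus_eq)
  moreover have "cmod a * cmod z < 1 * 1"
    using assms by (intro mult_strict_mono') auto
  ultimately show False by simp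
qed

lemma blaschke_eq_0_iff:
  assumes "cmod a < 1" "cmod z < 1"
  shows "blaschke a z = 0 \<longleftrightarrow> z = a"
  using one_minus_cnj_mult_nonzero[OF assms] by (auto simp: Moebius_function_simple)

text \<open>Moving the zero \<open>a\<close> to the origin turns this into the division of a function vanishing at \<open>0\<close>
  by the coordinate; the quotient keeps the bound \<open>1\<close> by the Schwarz lemma. That lemma asks for
  values in the open disc, so it is applied to \<open>s F\<close> with \<open>0 < s < 1\<close> before letting \<open>s\<close> tend
  to \<open>1\<close>.\<close>

lemma blaschke_division:
  assumes f: "f holomorphic_on unit_disc" and le1: "\<And>z. z \<in> unit_disc \<Longrightarrow> cmod (f z) \<le> 1"
    and a: "a \<in> unit_disc" and fa: "f a = 0"
  obtains h where "h holomorphic_on unit_disc" "\<And>z. z \<in> unit_disc \<Longrightarrow> cmod (h z) \<le> 1"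
    "\<And>z. z \<in> unit_disc \<Longrightarrow> f z = blaschke a z * h z"
proof -
  have na: "cmod a < 1" "cmod (-a) < 1" using a by auto
  have maps: "blaschke b ` unit_disc \<subseteq> unit_disc" if "cmod b < 1" for b
    using that Moebius_function_norm_lt_1 by auto
  define F where "F = f \<circ> blaschke (-a)"
  have F: "F holomorphic_on unit_disc"
    unfolding F_def using na maps[of "-a"] Moebius_function_holomorphic
    by (intro holomorphic_on_compose_gen[OF _ f]) auto
  have F0: "F 0 = 0" by (simp add: F_def Moebius_function_of_zero fa)
  have Fle: "cmod (F z) \<le> 1" if "cmod z < 1" for z
    using le1 Moebius_function_norm_lt_1[OF na(2) that] by (simp add: F_def)
  obtain h where h: "h holomorphic_on unit_disc" and Fh: "\<And>z. cmod z < 1 \<Longrightarrow> F z = z * h z"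
    and dF: "deriv F 0 = h 0"
    using Schwarz3[OF F F0] by blast
  have hle: "cmod (h z) \<le> 1" if z: "cmod z < 1" for z
  proof (rule field_le_mult_one_interval)
    fix s :: real assume s: "0 < s" "s < 1"
    let ?G = "\<lambda>w. of_real s * F w"
    have G: "?G holomorphic_on unit_disc" "?G 0 = 0"
      using F F0 by (auto intro!: holomorphic_intros)
    have Gl: "cmod (?G w) < 1" if "cmod w < 1" for w
    proof -
      have "s * cmod (F w) \<le> s * 1"
        using Fle[OF that] s by (intro mult_left_mono) auto
      also have "\<dots> < 1" using s by simp
      finally show ?thesis using s by (simp add: norm_mult)
    qed
    show "s * cmod (h z) \<le> 1"
    proof (cases "z = 0")
      case True
      have "deriv ?G 0 = of_real s * deriv F 0"
        using F by (intro deriv_cmult) (auto intro: holomorphic_on_imp_differentiable_at)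
      then show ?thesis
        using Schwarz_Lemma(2)[OF G Gl, of 0] dF s True by (simp add: norm_mult)
    next
      case False
      then have "s * cmod (h z) * cmod z \<le> 1 * cmod z"
        using Schwarz_Lemma(1)[OF G Gl z] Fh[OF z] s by (simp add: norm_mult mult_ac)
      then show ?thesis using False by simp
    qed
  qed
  show thesis
  proof
    show "(h \<circ> blaschke a) holomorphic_on unit_disc"
      using na maps[of a] Moebius_function_holomorphic
      by (intro holomorphic_on_compose_gen[OF _ h]) auto
    fix z :: complex assume z: "z \<in> unit_disc"
    then have Mz: "cmod (blaschke a z) < 1" using Moebius_function_norm_lt_1 na by simp
    show "cmod ((h \<circ> blaschke a) z) \<le> 1" using hle Mz by simp
    have "blaschke (-a) (blaschke a z) = z"
      using na z by (intro Moebius_function_compose) auto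
    then show "f z = blaschke a z * (h \<circ> blaschke a) z"
      using Fh[OF Mz] by (simp add: F_def)
  qed
qed

lemma blaschke_division2:
  assumes f: "f holomorphic_on unit_disc" and le1: "\<And>z. z \<in> unit_disc \<Longrightarrow> cmod (f z) \<le> 1"
    and a: "a \<in> unit_disc" "f a = 0" and b: "b \<in> unit_disc" "f b = 0" and ab: "a \<noteq> b"
  obtains h where "h holomorphic_on unit_disc" "\<And>z. z \<in> unit_disc \<Longrightarrow> cmod (h z) \<le> 1"
    "\<And>z. z \<in> unit_disc \<Longrightarrow> f z = blaschke a z * blaschke b z * h z"
proof -
  obtain g where g: "g holomorphic_on unit_disc" "\<And>z. z \<in> unit_disc \<Longrightarrow> cmod (g z) \<le> 1"
    and fg: "\<And>z. z \<in> unit_disc \<Longrightarrow> f z = blaschke a z * g z"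
    using blaschke_division[OF f le1 a] by blast
  have "blaschke a b \<noteq> 0" using a b ab by (simp add: blaschke_eq_0_iff)
  then have "g b = 0" using fg[OF b(1)] b(2) by simp
  then obtain h where "h holomorphic_on unit_disc" "\<And>z. z \<in> unit_disc \<Longrightarrow> cmod (h z) \<le> 1"
    "\<And>z. z \<in> unit_disc \<Longrightarrow> g z = blaschke b z * h z"
    using blaschke_division[OF g b(1)] by blast
  then show thesis using fg that by (metis mult.assoc)
qed

lemma norm_at_0_le_zeros:
  assumes f: "f holomorphic_on unit_disc" "\<And>z. z \<in> unit_disc \<Longrightarrow> cmod (f z) \<le> 1"
    and "a \<in> unit_disc" "f a = 0" "b \<in> unit_disc" "f b = 0" "a \<noteq> b"
  shows "cmod (f 0) \<le> cmod a * cmod b"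
proof -
  obtain h where "h holomorphic_on unit_disc" and h: "\<And>z. z \<in> unit_disc \<Longrightarrow> cmod (h z) \<le> 1"
    "\<And>z. z \<in> unit_disc \<Longrightarrow> f z = blaschke a z * blaschke b z * h z"
    using blaschke_division2[OF assms] by blast
  then have "cmod (f 0) = cmod a * cmod b * cmod (h 0)"
    by (simp add: Moebius_function_of_zero norm_mult)
  also have "\<dots> \<le> cmod a * cmod b * 1" using h(1)[of 0] by (intro mult_left_mono) auto
  finally show ?thesis by simp
qed

text \<open>The Schwarz lemma for \<open>(h - h 0) / 2\<close>. It expresses that a bounded factor cannot vary much near
  the origin.\<close>

lemma norm_diff_at_0_le:
  assumes h: "h holomorphic_on unit_disc" and le1: "\<And>z. z \<in> unit_disc \<Longrightarrow> cmod (h z) \<le> 1"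
    and a: "a \<in> unit_disc"
  shows "cmod (h a - h 0) \<le> 2 * cmod a"
proof -
  define g where "g = (\<lambda>z. (h z - h 0) / 2)"
  have g: "g holomorphic_on unit_disc" unfolding g_def using h by (intro holomorphic_intros) auto
  have gle: "cmod (g z) \<le> 1" if "z \<in> unit_disc" for z
    using norm_triangle_ineq4[of "h z" "h 0"] le1[OF that] le1[of 0] by (simp add: g_def norm_divide)
  have g0: "0 \<in> unit_disc" "g 0 = 0" by (auto simp: g_def)
  show ?thesis
  proof (rule blaschke_division[OF g gle g0])
    fix k
    assume "\<And>z. z \<in> unit_disc \<Longrightarrow> cmod (k z) \<le> 1"
      "\<And>z. z \<in> unit_disc \<Longrightarrow> g z = blaschke 0 z * k z"
    then have "g a = a * k a" "cmod (k a) \<le> 1"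
      using a by (auto simp: Moebius_function_simple)
    then have "cmod (g a) \<le> cmod a * 1"
      by (metis mult_left_mono norm_ge_zero norm_mult)
    then show "cmod (h a - h 0) \<le> 2 * cmod a" by (simp add: g_def norm_divide)
  qed
qed

section \<open>The Lempert function of the bidisc as an interpolation problem\<close>

lemma elog_mult:
  assumes "x \<ge> 0" "y \<ge> 0"
  shows "elog (x * y) = elog x + elog y"
  using assms by (auto simp: elog_def ln_mult)

lemma elog_mono:
  assumes "0 \<le> x" "x \<le> y"
  shows "elog x \<le> elog y"
  using assms by (auto simp: elog_def)

text \<open>A competitor in the infimum, written in coordinates. The letters \<open>\<zeta>0\<close>, \<open>\<zeta>1\<close>, \<open>\<zeta>2\<close> denote the
  preimages of the poles \<open>(0, 0)\<close>, \<open>(e1, 0)\<close>, \<open>(0, e2)\<close>.\<close>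

definition interpolating_disc ::
  "complex \<Rightarrow> complex \<Rightarrow> complex \<Rightarrow> complex \<Rightarrow> complex \<Rightarrow> complex \<Rightarrow> complex \<Rightarrow>
    (complex \<Rightarrow> complex) \<Rightarrow> (complex \<Rightarrow> complex) \<Rightarrow> bool" where
  "interpolating_disc e1 e2 z1 z2 \<zeta>0 \<zeta>1 \<zeta>2 f g \<longleftrightarrow>
     \<zeta>0 \<in> unit_disc \<and> \<zeta>1 \<in> unit_disc \<and> \<zeta>2 \<in> unit_disc \<and>
     f holomorphic_on unit_disc \<and> g holomorphic_on unit_disc \<and>
     f ` unit_disc \<subseteq> unit_disc \<and> g ` unit_disc \<subseteq> unit_disc \<and>
     f 0 = z1 \<and> f \<zeta>0 = 0 \<and> f \<zeta>1 = e1 \<and> f \<zeta>2 = 0 \<and>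
     g 0 = z2 \<and> g \<zeta>0 = 0 \<and> g \<zeta>1 = 0 \<and> g \<zeta>2 = e2"

lemma lempert_bidisc_eq_Inf:
  "lempert_bidisc (vector [e1, e2]) (vector [z1, z2]) =
     Inf {elog (cmod (\<zeta>0 * \<zeta>1 * \<zeta>2)) | \<zeta>0 \<zeta>1 \<zeta>2. \<exists>f g. interpolating_disc e1 e2 z1 z2 \<zeta>0 \<zeta>1 \<zeta>2 f g}"
  (is "_ = Inf ?R")
proof -
  let ?a = "\<lambda>j. [0, vector [e1, 0], vector [0, e2]] ! j :: complex ^ 2"
  let ?z = "vector [z1, z2] :: complex ^ 2"
  let ?L = "{(\<Sum>j\<le>2. elog (cmod (\<zeta> j))) | \<zeta>.
            (\<forall>j\<le>2. \<zeta> j \<in> unit_disc) \<and>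
            (\<exists>\<phi>. holomorphic_disc bidisc \<phi> \<and> \<phi> 0 = ?z \<and> (\<forall>j\<le>2. \<phi> (\<zeta> j) = ?a j))}"
  have le2: "(\<forall>j\<le>2. P j) \<longleftrightarrow> P 0 \<and> P (Suc 0) \<and> P 2" for P :: "nat \<Rightarrow> bool"
    by (auto simp: le_Suc_eq numeral_2_eq_2)
  have sum: "(\<Sum>j\<le>2. elog (cmod (\<zeta> j))) = elog (cmod (\<zeta> 0 * \<zeta> 1 * \<zeta> 2))" for \<zeta> :: "nat \<Rightarrow> complex"
    by (simp add: numeral_2_eq_2 norm_mult elog_mult)
  have 2: "?a 0 = 0" "?a (Suc 0) = vector [e1, 0]" "?a 2 = vector [0, e2]"
    by (auto simp: numeral_2_eq_2)
  have vec: "x = y \<longleftrightarrow> pr1 x = pr1 y \<and> pr2 x = pr2 y" for x y :: "complex ^ 2"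
    by (auto simp: vec_eq_iff forall_2)
  have "?L = ?R"
  proof (intro equalityI subsetI)
    fix s assume "s \<in> ?L"
    then obtain \<zeta> \<phi> where s: "s = elog (cmod (\<zeta> 0 * \<zeta> 1 * \<zeta> 2))"
      and \<zeta>: "\<forall>j\<le>2. \<zeta> j \<in> unit_disc" and \<phi>: "holomorphic_disc bidisc \<phi>" "\<phi> 0 = ?z"
      "\<forall>j\<le>2. \<phi> (\<zeta> j) = ?a j"
      unfolding sum by blast
    have "interpolating_disc e1 e2 z1 z2 (\<zeta> 0) (\<zeta> 1) (\<zeta> 2) (\<lambda>w. pr1 (\<phi> w)) (\<lambda>w. pr2 (\<phi> w))"
      using \<zeta> \<phi> unfolding interpolating_disc_def le2 2 holomorphic_disc_def bidisc_def
      by (auto simp: vec)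
    then show "s \<in> ?R" using s by blast
  next
    fix s assume "s \<in> ?R"
    then obtain \<zeta>0 \<zeta>1 \<zeta>2 f g where s: "s = elog (cmod (\<zeta>0 * \<zeta>1 * \<zeta>2))"
      and i: "interpolating_disc e1 e2 z1 z2 \<zeta>0 \<zeta>1 \<zeta>2 f g" by blast
    define \<zeta> where "\<zeta> = (\<lambda>j::nat. [\<zeta>0, \<zeta>1, \<zeta>2] ! j)"
    have \<zeta>: "\<zeta> 0 = \<zeta>0" "\<zeta> (Suc 0) = \<zeta>1" "\<zeta> 2 = \<zeta>2" by (auto simp: \<zeta>_def numeral_2_eq_2)
    define \<phi> where "\<phi> = (\<lambda>w. vector [f w, g w] :: complex ^ 2)"
    have "holomorphic_disc bidisc \<phi>"
      using i by (auto simp: holomorphic_disc_def interpolating_disc_def \<phi>_def bidisc_def forall_2)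
    moreover have "\<phi> 0 = ?z" "\<forall>j\<le>2. \<phi> (\<zeta> j) = ?a j" "\<forall>j\<le>2. \<zeta> j \<in> unit_disc"
      using i unfolding le2 2 \<zeta> by (auto simp: interpolating_disc_def \<phi>_def vec)
    moreover have "s = (\<Sum>j\<le>2. elog (cmod (\<zeta> j)))" unfolding sum using s \<zeta> by simp
    ultimately show "s \<in> ?L" by blast
  qed
  then show ?thesis by (simp add: lempert_bidisc_def lempert_def)
qed

lemma lempert_bidisc_le:
  assumes "interpolating_disc e1 e2 z1 z2 \<zeta>0 \<zeta>1 \<zeta>2 f g"
  shows "lempert_bidisc (vector [e1, e2]) (vector [z1, z2]) \<le> elog (cmod (\<zeta>0 * \<zeta>1 * \<zeta>2))"
  unfolding lempert_bidisc_eq_Inf using assms by (intro Inf_lower) blast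

text \<open>The exchange of the coordinates of \<open>\<complex>\<^sup>2\<close> exchanges the roles of \<open>\<zeta>1\<close> and \<open>\<zeta>2\<close>, hence the two
  coordinate axes need only one argument.\<close>

lemma lempert_bidisc_swap:
  "lempert_bidisc (vector [e2, e1]) (vector [z2, z1]) = lempert_bidisc (vector [e1, e2]) (vector [z1, z2])"
proof -
  have "lempert_bidisc (vector [e2, e1]) (vector [z2, z1]) \<le> lempert_bidisc (vector [e1, e2]) (vector [z1, z2])"
    for e1 e2 z1 z2
    unfolding lempert_bidisc_eq_Inf[of e1 e2]
  proof (rule Inf_greatest, clarify)
    fix \<zeta>0 \<zeta>1 \<zeta>2 f g assume "interpolating_disc e1 e2 z1 z2 \<zeta>0 \<zeta>1 \<zeta>2 f g"
    then have "interpolating_disc e2 e1 z2 z1 \<zeta>0 \<zeta>2 \<zeta>1 g f"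
      unfolding interpolating_disc_def by blast
    from lempert_bidisc_le[OF this]
    show "lempert_bidisc (vector [e2, e1]) (vector [z2, z1]) \<le> elog (cmod (\<zeta>0 * \<zeta>1 * \<zeta>2))"
      by (simp add: mult_ac)
  qed
  from antisym[OF this this] show ?thesis .
qed

lemma vector_2_components: "vector [pr1 x, pr2 x] = (x :: complex ^ 2)"
  by (auto simp: vec_eq_iff forall_2)

section \<open>Upper bounds from explicit discs\<close>

lemma tendsto_blaschke:
  assumes "(f \<longlongrightarrow> a) F" "(g \<longlongrightarrow> b) F" "cmod a < 1" "cmod b < 1"
  shows "((\<lambda>x. blaschke (f x) (g x)) \<longlongrightarrow> blaschke a b) F"
  unfolding Moebius_function_simple
  using assms one_minus_cnj_mult_nonzero by (intro tendsto_intros) auto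

text \<open>Two interpolation values \<open>A\<close> at \<open>0\<close> and \<open>B\<close> at \<open>p\<close> for the bounded factor are met by the affine
  function through them. When \<open>A\<close> and \<open>B\<close> are close to each other compared with \<open>p\<close>, this function
  is nearly constant, so it stays in the disc together with \<open>A\<close>.\<close>

lemma affine_blaschke_disc:
  assumes a: "cmod a < 1" and b: "cmod b < 1" and p: "cmod p < 1" "p \<noteq> 0"
    and AB: "cmod A + cmod (B - A) / cmod p < 1"
  obtains f where "f holomorphic_on unit_disc" "f ` unit_disc \<subseteq> unit_disc"
    "f 0 = a * b * A" "f a = 0" "f b = 0" "f p = blaschke a p * blaschke b p * B"
proof
  let ?f = "\<lambda>w. blaschke a w * blaschke b w * (A + (B - A) / p * w)"
  show "?f holomorphic_on unit_disc"
    using a b Moebius_function_holomorphic by (intro holomorphic_intros) auto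
  show "?f 0 = a * b * A" "?f a = 0" "?f b = 0" "?f p = blaschke a p * blaschke b p * B"
    using p by (auto simp: Moebius_function_of_zero Moebius_function_eq_zero)
  have "cmod (?f w) < 1" if w: "cmod w < 1" for w
  proof -
    have "cmod (A + (B - A) / p * w) \<le> cmod A + cmod (B - A) / cmod p * cmod w"
      using norm_triangle_ineq[of A "(B - A) / p * w"] by (simp add: norm_mult norm_divide)
    also have "\<dots> \<le> cmod A + cmod (B - A) / cmod p * 1"
      using w by (intro add_left_mono mult_left_mono) auto
    finally have "cmod (A + (B - A) / p * w) < 1" using AB by simp
    moreover have "cmod (blaschke a w) < 1" "cmod (blaschke b w) < 1"
      using a b w by (auto intro: Moebius_function_norm_lt_1)
    ultimately show ?thesis
      by (meson norm_mult_less mult_1 less_eq_real_def order_less_le_trans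
        norm_mult_less[of _ 1 _ 1, simplified])
  qed
  then show "?f ` unit_disc \<subseteq> unit_disc" by auto
qed

text \<open>The common principle behind all upper bounds. With \<open>\<zeta>0 = c\<close>, \<open>\<zeta>1 = u\<close>, \<open>\<zeta>2 = v\<close>, the bounded factor
  of the first component must take the value \<open>z1 / (c v)\<close> at \<open>0\<close> and the value in \<open>lim1\<close> at \<open>u\<close>.
  If both tend to the same \<open>A\<close> in the open disc while \<open>u\<close> stays away from \<open>0\<close>, an affine factor
  eventually does this; likewise for the second component. A choice of nodes thus has to satisfy
  the two conditions asymptotically only, and can be written down from their leading terms.\<close>

lemma Limsup_lempert_bidisc_le:
  fixes F :: "'a filter" and e1 e2 u v :: "'a \<Rightarrow> complex"
  assumes u: "(u \<longlongrightarrow> p) F" and v: "(v \<longlongrightarrow> q) F"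
    and c: "cmod c < 1" "c \<noteq> 0" and p: "cmod p < 1" "p \<noteq> 0" and q: "cmod q < 1" "q \<noteq> 0"
    and distinct: "\<forall>\<^sub>F x in F. u x \<noteq> c \<and> v x \<noteq> c \<and> u x \<noteq> v x"
    and A: "cmod A < 1" and B: "cmod B < 1"
    and lim1: "((\<lambda>x. e1 x / (blaschke c (u x) * blaschke (v x) (u x))) \<longlongrightarrow> A) F"
    and lim2: "((\<lambda>x. e2 x / (blaschke c (v x) * blaschke (u x) (v x))) \<longlongrightarrow> B) F"
    and z1: "z1 = c * q * A" and z2: "z2 = c * p * B"
    and K: "cmod (c * p * q) < K"
  shows "Limsup F (\<lambda>x. lempert_bidisc (vector [e1 x, e2 x]) (vector [z1, z2])) \<le> elog K"
proof (rule Limsup_bounded)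
  define A1 where "A1 = (\<lambda>x. z1 / (c * v x))"
  define A2 where "A2 = (\<lambda>x. e1 x / (blaschke c (u x) * blaschke (v x) (u x)))"
  define B1 where "B1 = (\<lambda>x. z2 / (c * u x))"
  define B2 where "B2 = (\<lambda>x. e2 x / (blaschke c (v x) * blaschke (u x) (v x)))"
  have "(A1 \<longlongrightarrow> z1 / (c * q)) F" "(B1 \<longlongrightarrow> z2 / (c * p)) F"
    unfolding A1_def B1_def using u v c p q by (auto intro!: tendsto_intros)
  then have lims: "(A1 \<longlongrightarrow> A) F" "(A2 \<longlongrightarrow> A) F" "(B1 \<longlongrightarrow> B) F" "(B2 \<longlongrightarrow> B) F"
    using lim1 lim2 c p q by (simp_all add: z1 z2 A2_def B2_def)
  have "((\<lambda>x. cmod (A1 x) + cmod (A2 x - A1 x) / cmod (u x)) \<longlongrightarrow> cmod A + cmod (A - A) / cmod p) F"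
    using p by (intro tendsto_intros lims u) auto
  then have ev1: "\<forall>\<^sub>F x in F. cmod (A1 x) + cmod (A2 x - A1 x) / cmod (u x) < 1"
    by (rule order_tendstoD) (use A in simp)
  have "((\<lambda>x. cmod (B1 x) + cmod (B2 x - B1 x) / cmod (v x)) \<longlongrightarrow> cmod B + cmod (B - B) / cmod q) F"
    using q by (intro tendsto_intros lims v) auto
  then have ev2: "\<forall>\<^sub>F x in F. cmod (B1 x) + cmod (B2 x - B1 x) / cmod (v x) < 1"
    by (rule order_tendstoD) (use B in simp)
  have ev3: "\<forall>\<^sub>F x in F. cmod (u x) < 1" "\<forall>\<^sub>F x in F. cmod (v x) < 1"
    using order_tendstoD(2)[OF tendsto_norm[OF u] p(1)] order_tendstoD(2)[OF tendsto_norm[OF v] q(1)]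
    by auto
  have ev4: "\<forall>\<^sub>F x in F. u x \<noteq> 0" "\<forall>\<^sub>F x in F. v x \<noteq> 0"
    using tendsto_imp_eventually_ne[OF u p(2)] tendsto_imp_eventually_ne[OF v q(2)] by auto
  have ev5: "\<forall>\<^sub>F x in F. cmod (c * u x * v x) < K"
    by (rule order_tendstoD[OF _ K]) (intro tendsto_intros u v)
  show "\<forall>\<^sub>F x in F. lempert_bidisc (vector [e1 x, e2 x]) (vector [z1, z2]) \<le> elog K"
    using distinct ev1 ev2 ev3 ev4 ev5
  proof eventually_elim
    case (elim x)
    obtain f where f: "f holomorphic_on unit_disc" "f ` unit_disc \<subseteq> unit_disc"
      "f 0 = c * v x * A1 x" "f c = 0" "f (v x) = 0"
      "f (u x) = blaschke c (u x) * blaschke (v x) (u x) * A2 x"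
      using affine_blaschke_disc[of c "v x" "u x" "A1 x" "A2 x"] elim c by metis
    obtain g where g: "g holomorphic_on unit_disc" "g ` unit_disc \<subseteq> unit_disc"
      "g 0 = c * u x * B1 x" "g c = 0" "g (u x) = 0"
      "g (v x) = blaschke c (v x) * blaschke (u x) (v x) * B2 x"
      using affine_blaschke_disc[of c "u x" "v x" "B1 x" "B2 x"] elim c by metis
    have "blaschke c (u x) \<noteq> 0" "blaschke c (v x) \<noteq> 0" "blaschke (u x) (v x) \<noteq> 0" "blaschke (v x) (u x) \<noteq> 0"
      using elim c by (auto simp: blaschke_eq_0_iff)
    then have "f (u x) = e1 x" "g (v x) = e2 x" "f 0 = z1" "g 0 = z2"
      using elim c f g by (simp_all add: A1_def A2_def B1_def B2_def)
    then have "interpolating_disc (e1 x) (e2 x) z1 z2 c (u x) (v x) f g"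
      using elim c f g by (simp add: interpolating_disc_def)
    then have "lempert_bidisc (vector [e1 x, e2 x]) (vector [z1, z2]) \<le> elog (cmod (c * u x * v x))"
      by (rule lempert_bidisc_le)
    also have "\<dots> \<le> elog K" using elim by (intro elog_mono) auto
    finally show ?case .
  qed
qed

text \<open>At \<open>z = 0\<close>, which is itself a pole, a disc with \<open>\<zeta>0 = 0\<close> makes the infimum equal to
  \<open>-\<infinity>\<close>.\<close>

lemma Limsup_lempert_bidisc_origin:
  fixes F :: "'a filter" and e1 e2 :: "'a \<Rightarrow> complex"
  assumes e1: "(e1 \<longlongrightarrow> 0) F" and e2: "(e2 \<longlongrightarrow> 0) F"
  shows "Limsup F (\<lambda>x. lempert_bidisc (vector [e1 x, e2 x]) (vector [0, 0])) \<le> elog 0"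
proof (rule Limsup_bounded)
  have "\<forall>\<^sub>F x in F. cmod (e1 x) < 1/3" "\<forall>\<^sub>F x in F. cmod (e2 x) < 1/3"
    using order_tendstoD(2)[OF tendsto_norm_zero[OF e1], of "1/3"]
      order_tendstoD(2)[OF tendsto_norm_zero[OF e2], of "1/3"] by simp_all
  then show "\<forall>\<^sub>F x in F. lempert_bidisc (vector [e1 x, e2 x]) (vector [0, 0]) \<le> elog 0"
  proof eventually_elim
    case (elim x)
    have bound: "cmod (e * w * (w + s) * 2) < 1"
      if "cmod e < 1/3" "cmod w < 1" "cmod s \<le> 1/2" for e w s
    proof -
      have "cmod (w + s) \<le> 3/2" using norm_triangle_ineq[of w s] that by simp
      then have "cmod e * (cmod w * cmod (w + s)) \<le> cmod e * (1 * (3/2))"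
        using that by (intro mult_left_mono mult_mono) auto
      then show ?thesis unfolding norm_mult using that by simp
    qed
    have "interpolating_disc (e1 x) (e2 x) 0 0 0 (1/2) (-1/2)
      (\<lambda>w. e1 x * w * (w + 1/2) * 2) (\<lambda>w. e2 x * w * (w + (-1/2)) * 2)"
      unfolding interpolating_disc_def
      using bound[of "e1 x" _ "1/2"] bound[of "e2 x" _ "-1/2"] elim
      by (auto intro!: holomorphic_intros)
    from lempert_bidisc_le[OF this] show ?case by simp
  qed
qed

text \<open>On the axis \<open>z2 = 0\<close> the bounded factor of \<open>g\<close> can be nearly \<open>0\<close>, which leaves \<open>\<zeta>1\<close> free to merge
  with \<open>\<zeta>0\<close>. The modulus of \<open>\<zeta>2 = q\<close> is between \<open>1/2\<close> and \<open>1\<close>, and \<open>\<zeta>0 = c\<close> has modulus comparable to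
  that of \<open>z\<close>, so the product of the three nodes is of the order of \<open>\<bar>z\<bar>\<^sup>2\<close>.\<close>

lemma Limsup_lempert_bidisc_axis:
  fixes F :: "'a filter" and e1 e2 :: "'a \<Rightarrow> complex"
  assumes e1: "(e1 \<longlongrightarrow> 0) F" and e2: "(e2 \<longlongrightarrow> 0) F" and nz: "\<forall>\<^sub>F x in F. e1 x \<noteq> 0"
    and z: "cmod z < 1"
  shows "Limsup F (\<lambda>x. lempert_bidisc (vector [e1 x, e2 x]) (vector [z, 0])) \<le> elog (8 * (cmod z)\<^sup>2)"
proof (cases "z = 0")
  case True
  then show ?thesis using Limsup_lempert_bidisc_origin[OF e1 e2] by simp
next
  case z0: False
  define r where "r = cmod z"
  \<comment> \<open>This choice gives \<open>r < t\<^sup>2\<close>, hence \<open>r / t\<^sup>2 < 1\<close>, while \<open>t > 1/2\<close> keeps \<open>r / t\<^sup>2\<close> of the order of \<open>r\<close>.\<close>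
  define t where "t = (1 + r) / 2"
  have r: "0 < r" "r < 1" using z z0 by (auto simp: r_def)
  have t: "1/2 < t" "t < 1" using r by (auto simp: t_def)
  have rt: "r / t\<^sup>2 < 1"
  proof -
    have "0 < (1 - r)\<^sup>2" using r by simp
    then show ?thesis using t by (simp add: t_def field_simps power2_eq_square)
  qed
  define c where "c = - complex_of_real (r / t\<^sup>2)"
  define q where "q = complex_of_real t"
  \<comment> \<open>The minus sign, also in \<open>c\<close>, keeps \<open>c\<close> and \<open>q\<close> apart: they lie on opposite rays.\<close>
  define A where "A = - of_real (t / r) * z"
  have c: "cmod c < 1" "c \<noteq> 0" using rt r t by (auto simp: c_def norm_divide norm_power)
  have q: "cmod q < 1" "q \<noteq> 0" using t by (auto simp: q_def)
  have cq: "c \<noteq> q"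
  proof
    assume "c = q"
    then have "Re c = Re q" by simp
    moreover have "r / t\<^sup>2 > 0" using r t by simp
    ultimately show False using t by (simp add: c_def q_def)
  qed
  have A: "cmod A < 1" "A \<noteq> 0" using r t z0 by (auto simp: A_def norm_mult norm_divide r_def)
  define D where "D = A * blaschke q c"
  have D: "D \<noteq> 0" using A c q cq by (simp add: D_def blaschke_eq_0_iff)
  define k where "k = 1 - cnj c * c"
  have k: "k \<noteq> 0" using one_minus_cnj_mult_nonzero c by (simp add: k_def)
  \<comment> \<open>To first order, \<open>blaschke c u\<close> is \<open>(u - c) / k\<close>; so this displacement of \<open>\<zeta>1\<close> gives its bounded factor the limit value \<open>A\<close>.\<close>
  define u where "u = (\<lambda>x. c + k * e1 x / D)"
  have "(u \<longlongrightarrow> c + k * 0 / D) F" unfolding u_def using D by (intro tendsto_intros e1) auto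
  then have u: "(u \<longlongrightarrow> c) F" by simp
  have uc: "\<forall>\<^sub>F x in F. u x \<noteq> c"
    using nz by eventually_elim (use D k in \<open>simp add: u_def\<close>)
  have uq: "\<forall>\<^sub>F x in F. u x \<noteq> q" using tendsto_imp_eventually_ne[OF u cq] .
  show ?thesis
  proof (rule Limsup_lempert_bidisc_le[OF u tendsto_const c c q])
    show "\<forall>\<^sub>F x in F. u x \<noteq> c \<and> q \<noteq> c \<and> u x \<noteq> q"
      using uc uq by eventually_elim (use cq in auto)
    show "cmod A < 1" "cmod (0::complex) < 1" using A by auto
    have "((\<lambda>x. D / k * (1 - cnj c * u x) / blaschke q (u x)) \<longlongrightarrow> D / k * (1 - cnj c * c) / blaschke q c) F"
      using k c q cq by (intro tendsto_intros tendsto_blaschke u) (auto simp: blaschke_eq_0_iff)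
    then have "((\<lambda>x. D / k * (1 - cnj c * u x) / blaschke q (u x)) \<longlongrightarrow> A) F"
      using k c q cq by (simp add: D_def blaschke_eq_0_iff flip: k_def)
    then show "((\<lambda>x. e1 x / (blaschke c (u x) * blaschke q (u x))) \<longlongrightarrow> A) F"
    proof (rule Lim_transform_eventually)
      show "\<forall>\<^sub>F x in F. D / k * (1 - cnj c * u x) / blaschke q (u x) = e1 x / (blaschke c (u x) * blaschke q (u x))"
        using nz
      proof eventually_elim
        case (elim x)
        have *: "blaschke c (u x) = k * e1 x / D / (1 - cnj c * u x)"
          by (simp add: Moebius_function_simple u_def)
        show ?case unfolding * using elim by (simp add: divide_simps)
      qed
    qed
    have "((\<lambda>x. e2 x / (blaschke c q * blaschke (u x) q)) \<longlongrightarrow> 0 / (blaschke c q * blaschke c q)) F"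
      using c q cq by (intro tendsto_intros tendsto_blaschke u e2) (auto simp: blaschke_eq_0_iff)
    then show "((\<lambda>x. e2 x / (blaschke c q * blaschke (u x) q)) \<longlongrightarrow> 0) F" by simp
    show "z = c * q * A" using r t by (simp add: c_def q_def A_def field_simps power2_eq_square)
    show "0 = c * c * 0" by simp
    have "1 < 8 * t ^ 3" using power_strict_mono[of "1/2" t 3] t by (simp add: power3_eq_cube)
    then have "r\<^sup>2 / t ^ 3 < 8 * r\<^sup>2" using r t by (simp add: divide_less_eq mult_ac)
    moreover have "cmod (c * c * q) = r\<^sup>2 / t ^ 3"
      using r t by (simp add: c_def q_def norm_mult norm_divide norm_power power2_eq_square power3_eq_cube)
    ultimately show "cmod (c * c * q) < 8 * (cmod z)\<^sup>2" by (simp add: r_def)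
  qed
qed

text \<open>Here \<open>\<zeta>1\<close> and \<open>\<zeta>2\<close> merge at a point \<open>q\<close> of modulus comparable to that of \<open>z\<close>, while \<open>\<zeta>0 = c\<close>
  has modulus between \<open>1/2\<close> and \<open>1\<close>. In the limit the two conditions at the merging nodes read
  \<open>A (\<zeta>1 - \<zeta>2) \<approx> e1 \<cdot> const\<close> and \<open>B (\<zeta>2 - \<zeta>1) \<approx> e2 \<cdot> const\<close> with the same constant, where \<open>A / B = z1 / z2\<close>; they are
  compatible exactly when \<open>e1 / e2\<close> tends to \<open>-(z1 / z2)\<close>.\<close>

lemma Limsup_lempert_bidisc_tangent:
  fixes F :: "'a filter" and e1 e2 :: "'a \<Rightarrow> complex"
  assumes e1: "(e1 \<longlongrightarrow> 0) F" and nz: "\<forall>\<^sub>F x in F. e1 x \<noteq> 0"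
    and z: "cmod z1 < 1" "cmod z2 < 1" "z1 \<noteq> 0" "z2 \<noteq> 0"
    and lim: "((\<lambda>x. e1 x / e2 x) \<longlongrightarrow> - (z1 / z2)) F"
  shows "Limsup F (\<lambda>x. lempert_bidisc (vector [e1 x, e2 x]) (vector [z1, z2]))
    \<le> elog (8 * (max (cmod z1) (cmod z2))\<^sup>2)"
proof -
  define r where "r = max (cmod z1) (cmod z2)"
  define t where "t = (1 + r) / 2"
  have r: "0 < r" "r < 1" using z by (auto simp: r_def less_max_iff_disj)
  have t: "1/2 < t" "t < 1" using r by (auto simp: t_def)
  have rt: "r / t\<^sup>2 < 1"
  proof -
    have "0 < (1 - r)\<^sup>2" using r by simp
    then show ?thesis using t by (simp add: t_def field_simps power2_eq_square)
  qed
  define q where "q = - complex_of_real (r / t\<^sup>2)"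
  define c where "c = complex_of_real t"
  define A where "A = z1 / (c * q)"
  define B where "B = z2 / (c * q)"
  have q: "cmod q < 1" "q \<noteq> 0" using rt r t by (auto simp: q_def norm_divide norm_power)
  have c: "cmod c < 1" "c \<noteq> 0" using t by (auto simp: c_def)
  have cq: "c \<noteq> q"
  proof
    assume "c = q"
    then have "Re c = Re q" by simp
    moreover have "r / t\<^sup>2 > 0" using r t by simp
    ultimately show False using t by (simp add: c_def q_def)
  qed
  have ncq: "cmod (c * q) = r / t"
    using r t by (simp add: c_def q_def norm_mult norm_divide norm_power power2_eq_square)
  have "cmod z / (r / t) < 1" if "cmod z \<le> r" for z
  proof -
    have "cmod z * t \<le> r * t" using that t by simp
    also have "\<dots> < r" using r t by simp
    finally show ?thesis using r t by simp
  qed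
  then have AB: "cmod A < 1" "cmod B < 1"
    unfolding A_def B_def norm_divide ncq by (auto simp: r_def)
  have A0: "A \<noteq> 0" using c q z by (simp add: A_def)
  define D where "D = A * blaschke c q"
  have b0: "blaschke c q \<noteq> 0" using c q cq by (simp add: blaschke_eq_0_iff)
  have D: "D \<noteq> 0" using A0 b0 by (simp add: D_def)
  define k where "k = 1 - cnj q * q"
  have k: "k \<noteq> 0" using one_minus_cnj_mult_nonzero q by (simp add: k_def)
  \<comment> \<open>The displacement is read off from the linearised condition at \<open>\<zeta>1\<close>; the condition at \<open>\<zeta>2 = q\<close> then holds by the limit of \<open>e1 / e2\<close>.\<close>
  define u where "u = (\<lambda>x. q + k * e1 x / D)"
  have "(u \<longlongrightarrow> q + k * 0 / D) F" unfolding u_def using D by (intro tendsto_intros e1) auto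
  then have u: "(u \<longlongrightarrow> q) F" by simp
  have uq: "\<forall>\<^sub>F x in F. u x \<noteq> q"
    using nz by eventually_elim (use D k in \<open>simp add: u_def\<close>)
  have uc: "\<forall>\<^sub>F x in F. u x \<noteq> c" using tendsto_imp_eventually_ne[OF u cq[symmetric]] .
  show ?thesis
  proof (rule Limsup_lempert_bidisc_le[OF u tendsto_const c q q])
    show "\<forall>\<^sub>F x in F. u x \<noteq> c \<and> q \<noteq> c \<and> u x \<noteq> q"
      using uc uq by eventually_elim (use cq in auto)
    show "cmod A < 1" "cmod B < 1" using AB by auto
    have "((\<lambda>x. D / k * (1 - cnj q * u x) / blaschke c (u x)) \<longlongrightarrow> D / k * (1 - cnj q * q) / blaschke c q) F"
      using k c q b0 by (intro tendsto_intros tendsto_blaschke u) auto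
    then have "((\<lambda>x. D / k * (1 - cnj q * u x) / blaschke c (u x)) \<longlongrightarrow> A) F"
      using k b0 by (simp add: D_def flip: k_def)
    then show "((\<lambda>x. e1 x / (blaschke c (u x) * blaschke q (u x))) \<longlongrightarrow> A) F"
    proof (rule Lim_transform_eventually)
      show "\<forall>\<^sub>F x in F. D / k * (1 - cnj q * u x) / blaschke c (u x) = e1 x / (blaschke c (u x) * blaschke q (u x))"
        using nz
      proof eventually_elim
        case (elim x)
        have *: "blaschke q (u x) = k * e1 x / D / (1 - cnj q * u x)"
          by (simp add: Moebius_function_simple u_def)
        show ?case unfolding * using elim by (simp add: divide_simps)
      qed
    qed
    have "((\<lambda>x. - (inverse (e1 x / e2 x) * A * (1 - cnj (u x) * q) / k))
        \<longlongrightarrow> - (inverse (- (z1 / z2)) * A * (1 - cnj q * q) / k)) F"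
      using k z by (intro tendsto_intros u lim) auto
    also have "- (inverse (- (z1 / z2)) * A * (1 - cnj q * q) / k) = B"
      using k z c q by (simp add: A_def B_def flip: k_def)
    finally show "((\<lambda>x. e2 x / (blaschke c q * blaschke (u x) q)) \<longlongrightarrow> B) F"
    proof (rule Lim_transform_eventually)
      show "\<forall>\<^sub>F x in F. - (inverse (e1 x / e2 x) * A * (1 - cnj (u x) * q) / k) =
          e2 x / (blaschke c q * blaschke (u x) q)"
        using nz
      proof eventually_elim
        case (elim x)
        have *: "blaschke (u x) q = - (k * e1 x / D) / (1 - cnj (u x) * q)"
          by (simp add: Moebius_function_simple u_def)
        show ?case unfolding * using elim A0 b0 k by (simp add: D_def divide_simps)
      qed
    qed
    show "z1 = c * q * A" "z2 = c * q * B" using c q by (auto simp: A_def B_def)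
    have "1 < 8 * t ^ 3" using power_strict_mono[of "1/2" t 3] t by (simp add: power3_eq_cube)
    then have "r\<^sup>2 / t ^ 3 < 8 * r\<^sup>2" using r t by (simp add: divide_less_eq mult_ac)
    moreover have "cmod (c * q * q) = r\<^sup>2 / t ^ 3"
      using r t by (simp add: c_def q_def norm_mult norm_divide norm_power power2_eq_square power3_eq_cube)
    ultimately show "cmod (c * q * q) < 8 * (max (cmod z1) (cmod z2))\<^sup>2" by (simp add: r_def)
  qed
qed

text \<open>The displacements of merging nodes are given below through their squares.\<close>

lemma tendsto_0_if_square_bounded:
  fixes f g :: "'a \<Rightarrow> complex"
  assumes g: "(g \<longlongrightarrow> 0) F" and le: "\<forall>\<^sub>F x in F. cmod ((f x)\<^sup>2) \<le> C * cmod (g x)"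
  shows "(f \<longlongrightarrow> 0) F"
proof (rule Lim_null_comparison)
  show "\<forall>\<^sub>F x in F. norm (f x) \<le> sqrt (C * cmod (g x))"
    using le by eventually_elim (simp add: norm_power real_le_rsqrt)
  have "((\<lambda>x. sqrt (C * cmod (g x))) \<longlongrightarrow> sqrt (C * 0)) F"
    by (intro tendsto_intros tendsto_norm_zero g)
  then show "((\<lambda>x. sqrt (C * cmod (g x))) \<longlongrightarrow> 0) F" by simp
qed

text \<open>Now all three nodes merge at a point \<open>c\<close> with \<open>\<bar>c\<bar>\<^sup>2\<close> comparable to the norm of \<open>z\<close>. For
  \<open>\<zeta>1 = c + w\<close> and \<open>\<zeta>2 = c + y\<close> the leading parts of the two conditions are
  \<open>A w (w - y) = k\<^sup>2 e1\<close> and \<open>B y (y - w) = k\<^sup>2 e2\<close>, where \<open>k = 1 - \<bar>c\<bar>\<^sup>2\<close>. Their quotient gives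
  \<open>w = - \<rho> y\<close> with \<open>\<rho> = (e1 / e2) (z2 / z1)\<close>, and then \<open>y\<^sup>2 = k\<^sup>2 e2 / (B (1 + \<rho>))\<close> and
  \<open>w\<^sup>2 = k\<^sup>2 e1 \<rho> / (A (1 + \<rho>))\<close>. Both displacements tend to \<open>0\<close> as soon as \<open>1 + \<rho>\<close> is bounded
  below by a multiple of \<open>1\<close> and of \<open>\<bar>\<rho>\<bar>\<close>, which is the transversality assumption.\<close>

lemma Limsup_lempert_bidisc_transversal:
  fixes F :: "'a filter" and e1 e2 :: "'a \<Rightarrow> complex"
  assumes e1: "(e1 \<longlongrightarrow> 0) F" and e2: "(e2 \<longlongrightarrow> 0) F"
    and nz: "\<forall>\<^sub>F x in F. e1 x \<noteq> 0 \<and> e2 x \<noteq> 0"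
    and z: "cmod z1 < 1" "cmod z2 < 1" "z1 \<noteq> 0" "z2 \<noteq> 0"
    and m: "m > 0"
    and transversal: "\<forall>\<^sub>F x in F. m * max 1 (cmod (e1 x / e2 x * (z2 / z1))) \<le> cmod (1 + e1 x / e2 x * (z2 / z1))"
  shows "Limsup F (\<lambda>x. lempert_bidisc (vector [e1 x, e2 x]) (vector [z1, z2]))
    \<le> elog (sqrt (2 * max (cmod z1) (cmod z2)) ^ 3)"
proof -
  define r where "r = max (cmod z1) (cmod z2)"
  define t where "t = (1 + r) / 2"
  have r: "0 < r" "r < 1" using z by (auto simp: r_def less_max_iff_disj)
  have t: "1/2 < t" "t < 1" "r < t\<^sup>2" "r < t"
  proof -
    show "1/2 < t" "t < 1" "r < t" using r by (auto simp: t_def)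
    have "0 < (1 - r)\<^sup>2" using r by simp
    then show "r < t\<^sup>2" by (simp add: t_def field_simps power2_eq_square)
  qed
  define c where "c = complex_of_real (sqrt (r / t))"
  have cc: "c * c = of_real (r / t)" using r t by (simp add: c_def flip: of_real_mult)
  have nc: "cmod c = sqrt (r / t)" using r t by (simp add: c_def)
  have c: "cmod c < 1" "c \<noteq> 0" using r t by (simp_all add: nc c_def)
  define A where "A = z1 / (c * c)"
  define B where "B = z2 / (c * c)"
  have "cmod z / (r / t) < 1" if "cmod z \<le> r" for z
  proof -
    have "cmod z * t \<le> r * t" using that t by simp
    also have "\<dots> < r" using r t by simp
    finally show ?thesis using r t by simp
  qed
  moreover have "cmod (c * c) = r / t" unfolding cc using r t by (simp add: norm_divide)
  ultimately have AB: "cmod A < 1" "cmod B < 1"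
    unfolding A_def B_def norm_divide by (auto simp: r_def)
  have AB0: "A \<noteq> 0" "B \<noteq> 0" using c z by (auto simp: A_def B_def)
  define k where "k = 1 - cnj c * c"
  have k: "k \<noteq> 0" using one_minus_cnj_mult_nonzero c by (simp add: k_def)
  define \<rho> where "\<rho> = (\<lambda>x. e1 x / e2 x * (z2 / z1))"
  define y where "y = (\<lambda>x. csqrt (k\<^sup>2 * e2 x / (B * (1 + \<rho> x))))"
  define w where "w = (\<lambda>x. - \<rho> x * y x)"
  have y2: "(y x)\<^sup>2 = k\<^sup>2 * e2 x / (B * (1 + \<rho> x))" for x by (simp add: y_def)
  have z21: "z2 / z1 = B / A" using c z by (simp add: A_def B_def)
  have ev: "\<forall>\<^sub>F x in F. e1 x \<noteq> 0 \<and> e2 x \<noteq> 0 \<and> 1 + \<rho> x \<noteq> 0 \<and> \<rho> x \<noteq> 0 \<and>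
      m \<le> cmod (1 + \<rho> x) \<and> m * cmod (\<rho> x) \<le> cmod (1 + \<rho> x)"
    using nz transversal
  proof eventually_elim
    case (elim x)
    have le: "m * max 1 (cmod (\<rho> x)) \<le> cmod (1 + \<rho> x)" using elim by (simp add: \<rho>_def)
    moreover have "m * 1 \<le> m * max 1 (cmod (\<rho> x))" "m * cmod (\<rho> x) \<le> m * max 1 (cmod (\<rho> x))"
      using m by (auto intro!: mult_left_mono)
    ultimately have 1: "m \<le> cmod (1 + \<rho> x)" "m * cmod (\<rho> x) \<le> cmod (1 + \<rho> x)" by auto
    moreover have "1 + \<rho> x \<noteq> 0" using 1(1) m by auto
    moreover have "\<rho> x \<noteq> 0" using elim z by (simp add: \<rho>_def)
    ultimately show ?case using elim by blast
  qed
  have y: "(y \<longlongrightarrow> 0) F"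
  proof (rule tendsto_0_if_square_bounded[OF e2])
    show "\<forall>\<^sub>F x in F. cmod ((y x)\<^sup>2) \<le> cmod (k\<^sup>2 / B) / m * cmod (e2 x)"
      using ev
    proof eventually_elim
      case (elim x)
      have "cmod ((y x)\<^sup>2) = cmod (k\<^sup>2 / B) * cmod (e2 x) / cmod (1 + \<rho> x)"
        unfolding y2 by (simp add: norm_mult norm_divide)
      also have "\<dots> \<le> cmod (k\<^sup>2 / B) * cmod (e2 x) / m"
        using elim m by (intro divide_left_mono) auto
      finally show ?case by simp
    qed
  qed
  have w2: "(w x)\<^sup>2 = \<rho> x * (k\<^sup>2 * e1 x) / (A * (1 + \<rho> x))" if "e2 x \<noteq> 0" for x
  proof -
    have "(w x)\<^sup>2 = \<rho> x * (\<rho> x * (y x)\<^sup>2)" by (simp add: w_def power2_eq_square)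
    also have "\<rho> x * (y x)\<^sup>2 = k\<^sup>2 * e1 x / (A * (1 + \<rho> x))"
      unfolding y2 using that AB0 by (simp add: \<rho>_def z21)
    finally show ?thesis by simp
  qed
  have w: "(w \<longlongrightarrow> 0) F"
  proof (rule tendsto_0_if_square_bounded[OF e1])
    show "\<forall>\<^sub>F x in F. cmod ((w x)\<^sup>2) \<le> cmod (k\<^sup>2 / A) / m * cmod (e1 x)"
      using ev
    proof eventually_elim
      case (elim x)
      have "cmod ((w x)\<^sup>2) = cmod (k\<^sup>2 / A) * cmod (e1 x) * (cmod (\<rho> x) / cmod (1 + \<rho> x))"
        using elim by (simp add: w2 norm_mult norm_divide)
      also have "\<dots> \<le> cmod (k\<^sup>2 / A) * cmod (e1 x) * (1 / m)"
        using elim m by (intro mult_left_mono) (auto simp: field_simps)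
      finally show ?case by simp
    qed
  qed
  define u where "u = (\<lambda>x. c + w x)"
  define v where "v = (\<lambda>x. c + y x)"
  have "(u \<longlongrightarrow> c + 0) F" "(v \<longlongrightarrow> c + 0) F" unfolding u_def v_def by (intro tendsto_intros w y)+
  then have u: "(u \<longlongrightarrow> c) F" and v: "(v \<longlongrightarrow> c) F" by auto
  have lim: "((\<lambda>x. H * (1 - cnj c * f x) * (1 - cnj (g x) * f x) / k\<^sup>2) \<longlongrightarrow> H) F"
    if "(f \<longlongrightarrow> c) F" "(g \<longlongrightarrow> c) F" for H f g
  proof -
    have "((\<lambda>x. H * (1 - cnj c * f x) * (1 - cnj (g x) * f x) / k\<^sup>2) \<longlongrightarrow>
        H * (1 - cnj c * c) * (1 - cnj c * c) / k\<^sup>2) F"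
      using k by (intro tendsto_intros that) auto
    then show ?thesis using k by (simp add: power2_eq_square flip: k_def)
  qed
  have quotient: "H * a * b / k\<^sup>2 = e / ((p / a) * (q / b))" if "H * (p * q) = k\<^sup>2 * e" "p \<noteq> 0" "q \<noteq> 0"
    for H a b e p q :: complex
  proof -
    have "e = H * (p * q) / k\<^sup>2" using that k by simp
    then show ?thesis using that k by (simp add: divide_simps)
  qed
  have y0: "y x \<noteq> 0" if "e2 x \<noteq> 0" "1 + \<rho> x \<noteq> 0" for x
    using y2[of x] that k AB0 by auto
  show ?thesis
  proof (rule Limsup_lempert_bidisc_le[OF u v c c c])
    show "\<forall>\<^sub>F x in F. u x \<noteq> c \<and> v x \<noteq> c \<and> u x \<noteq> v x"
      using ev
    proof eventually_elim
      case (elim x)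
      have "w x - y x = - (1 + \<rho> x) * y x" by (simp add: w_def algebra_simps)
      moreover have "(1 + \<rho> x) * y x \<noteq> 0" using elim y0[of x] by simp
      ultimately have "w x \<noteq> y x" by (metis eq_iff_diff_eq_0 minus_mult_left neg_equal_0_iff_equal)
      then show ?case using elim y0[of x] by (auto simp: u_def v_def w_def)
    qed
    show "cmod A < 1" "cmod B < 1" by fact+
    show "((\<lambda>x. e1 x / (blaschke c (u x) * blaschke (v x) (u x))) \<longlongrightarrow> A) F"
    proof (rule Lim_transform_eventually[OF lim[OF u v]])
      show "\<forall>\<^sub>F x in F. A * (1 - cnj c * u x) * (1 - cnj (v x) * u x) / k\<^sup>2 =
          e1 x / (blaschke c (u x) * blaschke (v x) (u x))"
        using ev
      proof eventually_elim
        case (elim x)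
        have wy: "w x - y x = - (1 + \<rho> x) * y x" by (simp add: w_def algebra_simps)
        have "w x * (w x - y x) = (1 + \<rho> x) * (\<rho> x * (y x)\<^sup>2)"
          unfolding wy by (simp add: w_def power2_eq_square algebra_simps)
        also have "\<rho> x * (y x)\<^sup>2 = k\<^sup>2 * e1 x / (A * (1 + \<rho> x))"
          unfolding y2 using elim AB0 by (simp add: \<rho>_def z21)
        finally have "A * (w x * (w x - y x)) = k\<^sup>2 * e1 x" using elim AB0 by simp
        moreover have "w x - y x \<noteq> 0"
          unfolding wy mult_eq_0_iff neg_equal_0_iff_equal using elim y0[of x] by blast
        moreover have "w x \<noteq> 0" using elim y0[of x] by (simp add: w_def)
        ultimately show ?case
          using quotient[of A "w x" "w x - y x" "e1 x"]
          by (simp add: Moebius_function_simple u_def v_def)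
      qed
    qed
    show "((\<lambda>x. e2 x / (blaschke c (v x) * blaschke (u x) (v x))) \<longlongrightarrow> B) F"
    proof (rule Lim_transform_eventually[OF lim[OF v u]])
      show "\<forall>\<^sub>F x in F. B * (1 - cnj c * v x) * (1 - cnj (u x) * v x) / k\<^sup>2 =
          e2 x / (blaschke c (v x) * blaschke (u x) (v x))"
        using ev
      proof eventually_elim
        case (elim x)
        have yw: "y x - w x = (1 + \<rho> x) * y x" by (simp add: w_def algebra_simps)
        have "y x * (y x - w x) = (1 + \<rho> x) * (y x)\<^sup>2"
          unfolding yw by (simp add: power2_eq_square)
        then have "B * (y x * (y x - w x)) = k\<^sup>2 * e2 x" unfolding y2 using elim AB0 by simp
        moreover have "y x - w x \<noteq> 0" unfolding yw using elim y0[of x] by simp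
        moreover have "y x \<noteq> 0" using elim y0[of x] by simp
        ultimately show ?case
          using quotient[of B "y x" "y x - w x" "e2 x"]
          by (simp add: Moebius_function_simple u_def v_def)
      qed
    qed
    show "z1 = c * c * A" "z2 = c * c * B" using c by (auto simp: A_def B_def)
    have "r / t < 2 * r" using r t by (simp add: field_simps)
    then have "sqrt (r / t) ^ 3 < sqrt (2 * r) ^ 3"
      using r t by (intro power_strict_mono) auto
    then show "cmod (c * c * c) < sqrt (2 * max (cmod z1) (cmod z2)) ^ 3"
      by (simp add: norm_mult nc r_def power3_eq_cube)
  qed
qed

section \<open>The lower bound\<close>

lemma norm_prod_list_minus_1_le:
  fixes xs :: "complex list"
  assumes "\<forall>x \<in> set xs. cmod (x - 1) \<le> s" "2 * s * length xs \<le> 1" "s \<ge> 0"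
  shows "cmod (prod_list xs - 1) \<le> 2 * s * length xs"
  using assms
proof (induction xs)
  case (Cons a xs)
  have IH: "cmod (prod_list xs - 1) \<le> 2 * s * length xs" and a: "cmod (a - 1) \<le> s"
    using Cons by (auto simp: algebra_simps)
  have le1: "2 * s * length xs \<le> 1" using Cons.prems by (simp add: algebra_simps)
  have "cmod (prod_list xs) \<le> 2"
    using norm_triangle_ineq[of "prod_list xs - 1" 1] IH le1 by simp
  then have "cmod ((a - 1) * prod_list xs) \<le> s * 2"
    unfolding norm_mult using a by (intro mult_mono) (auto intro: order_trans[OF norm_ge_zero])
  moreover have "prod_list (a # xs) - 1 = (a - 1) * prod_list xs + (prod_list xs - 1)"
    by (simp add: algebra_simps)
  ultimately show ?case
    using norm_triangle_ineq[of "(a - 1) * prod_list xs" "prod_list xs - 1"] IH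
    by (simp add: algebra_simps)
qed simp

lemma norm_inverse_minus_1_le:
  fixes a :: complex
  assumes "cmod (a - 1) \<le> s" "s \<le> 1/2"
  shows "cmod (inverse a - 1) \<le> 2 * s"
proof -
  have "1/2 \<le> cmod a"
    using norm_triangle_ineq2[of 1 "1 - a"] assms by (simp add: norm_minus_commute)
  moreover from this have "a \<noteq> 0" by auto
  then have "inverse a - 1 = - ((a - 1) / a)" by (simp add: divide_simps)
  ultimately have "cmod (inverse a - 1) = cmod (a - 1) / cmod a" by (simp add: norm_divide)
  also have "\<dots> \<le> s / (1/2)"
    using assms \<open>1/2 \<le> cmod a\<close> by (intro frac_le) (auto intro: order_trans[OF norm_ge_zero])
  finally show ?thesis by simp
qed

text \<open>These inequalities compare a condition on the arguments of complex numbers with a condition on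
  the numbers themselves; the second one is what matters for large \<open>x\<close>.\<close>

lemma norm_sgn_add_1_le:
  fixes x :: complex
  shows "cmod (sgn x + 1) \<le> 2 * cmod (x + 1)" "cmod x * cmod (sgn x + 1) \<le> 2 * cmod (x + 1)"
proof -
  have *: "cmod (of_real (cmod x) - 1) \<le> cmod (x + 1)"
  proof -
    have "cmod (of_real (cmod x) - 1) = \<bar>cmod x - cmod (- 1 :: complex)\<bar>"
      by (metis norm_minus_cancel norm_of_real norm_one of_real_1 of_real_diff)
    also have "\<dots> \<le> cmod (x - (- 1))" by (rule norm_triangle_ineq3)
    finally show ?thesis by simp
  qed
  have x: "x = of_real (cmod x) * sgn x" by (cases "x = 0") (auto simp: sgn_eq)
  show "cmod (sgn x + 1) \<le> 2 * cmod (x + 1)"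
  proof -
    have "sgn x + 1 = (x + 1) - (of_real (cmod x) - 1) * sgn x"
      using x by (simp add: algebra_simps)
    also have "cmod \<dots> \<le> cmod (x + 1) + cmod (of_real (cmod x) - 1) * cmod (sgn x)"
      using norm_triangle_ineq4[of "x + 1" "(of_real (cmod x) - 1) * sgn x"] by (simp add: norm_mult)
    also have "\<dots> \<le> cmod (x + 1) + cmod (of_real (cmod x) - 1) * 1"
      by (intro add_left_mono mult_left_mono) (auto simp: norm_sgn)
    finally show ?thesis using * by simp
  qed
  have "cmod x * cmod (sgn x + 1) = cmod (of_real (cmod x) * (sgn x + 1))" by (simp add: norm_mult)
  also have "of_real (cmod x) * (sgn x + 1) = (x + 1) + (of_real (cmod x) - 1)"
    using x by (simp add: algebra_simps)
  also have "cmod \<dots> \<le> cmod (x + 1) + cmod (of_real (cmod x) - 1)" by (rule norm_triangle_ineq)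
  finally show "cmod x * cmod (sgn x + 1) \<le> 2 * cmod (x + 1)" using * by simp
qed

text \<open>The Lempert function measures the product of all three nodes; through these bounds a small product
  makes \<open>\<zeta>1\<close> and \<open>\<zeta>2\<close> small.\<close>

lemma interpolating_disc_norm_le:
  assumes "interpolating_disc e1 e2 z1 z2 \<zeta>0 \<zeta>1 \<zeta>2 f g" "e1 \<noteq> 0" "e2 \<noteq> 0"
  shows "cmod z1 \<le> cmod \<zeta>0 * cmod \<zeta>2" "cmod z2 \<le> cmod \<zeta>0 * cmod \<zeta>1"
proof -
  have in_disc: "\<zeta>0 \<in> unit_disc" "\<zeta>1 \<in> unit_disc" "\<zeta>2 \<in> unit_disc"
    and f: "f holomorphic_on unit_disc" "f ` unit_disc \<subseteq> unit_disc"
    and g: "g holomorphic_on unit_disc" "g ` unit_disc \<subseteq> unit_disc"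
    and vals: "f 0 = z1" "f \<zeta>0 = 0" "f \<zeta>1 = e1" "f \<zeta>2 = 0" "g 0 = z2" "g \<zeta>0 = 0" "g \<zeta>1 = 0" "g \<zeta>2 = e2"
    using assms(1) unfolding interpolating_disc_def by blast+
  have ne: "\<zeta>0 \<noteq> \<zeta>2" "\<zeta>0 \<noteq> \<zeta>1" using vals assms(2,3) by auto
  have le1: "cmod (f w) \<le> 1" "cmod (g w) \<le> 1" if "w \<in> unit_disc" for w
    using f g that by (auto simp: image_subset_iff less_imp_le)
  show "cmod z1 \<le> cmod \<zeta>0 * cmod \<zeta>2"
    using norm_at_0_le_zeros[OF f(1) le1(1) in_disc(1) vals(2) in_disc(3) vals(4) ne(1)]
    unfolding vals .
  show "cmod z2 \<le> cmod \<zeta>0 * cmod \<zeta>1"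
    using norm_at_0_le_zeros[OF g(1) le1(2) in_disc(1) vals(6) in_disc(2) vals(7) ne(2)]
    unfolding vals .
qed

text \<open>If \<open>\<zeta>1\<close> and \<open>\<zeta>2\<close> are small, also relative to \<open>\<zeta>0\<close>, and relative to the values at \<open>0\<close> of the bounded
  factors, then those factors hardly vary between \<open>0\<close> and the node concerned. For \<open>e1\<close> small enough
  in terms of \<open>z1\<close> this forces \<open>\<zeta>1 / \<zeta>2\<close> to be near \<open>1\<close>, since the factor with zero \<open>\<zeta>2\<close> is then the
  only factor of \<open>e1 = f \<zeta>1\<close> that can be small compared with \<open>z1\<close>. Dividing the formulas for \<open>e1\<close>, \<open>e2\<close>, \<open>z1\<close>, \<open>z2\<close>
  by one another writes \<open>- (e1 / e2) (z2 / z1)\<close> as a product of nine numbers near \<open>1\<close>.\<close>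

lemma ratio_near_minus_1:
  assumes disc: "interpolating_disc e1 e2 z1 z2 \<zeta>0 \<zeta>1 \<zeta>2 f g"
    and nz: "z1 \<noteq> 0" "z2 \<noteq> 0" "e1 \<noteq> 0" "e2 \<noteq> 0"
    and \<kappa>: "0 < \<kappa>" "\<kappa> \<le> 1/72"
    and e1: "cmod e1 \<le> \<kappa> * cmod z1 ^ 3 / 16"
    and \<zeta>1: "cmod \<zeta>1 \<le> \<kappa>" "cmod \<zeta>1 \<le> \<kappa> * cmod \<zeta>0"
    and \<zeta>2: "cmod \<zeta>2 \<le> \<kappa>" "cmod \<zeta>2 \<le> \<kappa> * cmod \<zeta>0"
    and P1: "cmod (\<zeta>0 * \<zeta>1 * \<zeta>2) \<le> \<kappa> * cmod z1" and P2: "cmod (\<zeta>0 * \<zeta>1 * \<zeta>2) \<le> \<kappa> * cmod z2"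
  shows "cmod (e1 / e2 * (z2 / z1) + 1) \<le> 72 * \<kappa>"
proof -
  have in_disc: "cmod \<zeta>0 < 1" "cmod \<zeta>1 < 1" "cmod \<zeta>2 < 1"
    and f: "f holomorphic_on unit_disc" "f ` unit_disc \<subseteq> unit_disc"
    and g: "g holomorphic_on unit_disc" "g ` unit_disc \<subseteq> unit_disc"
    and vals: "f 0 = z1" "f \<zeta>0 = 0" "f \<zeta>1 = e1" "f \<zeta>2 = 0" "g 0 = z2" "g \<zeta>0 = 0" "g \<zeta>1 = 0" "g \<zeta>2 = e2"
    using disc by (auto simp: interpolating_disc_def)
  have ne: "\<zeta>0 \<noteq> \<zeta>1" "\<zeta>0 \<noteq> \<zeta>2" "\<zeta>1 \<noteq> \<zeta>2" "\<zeta>0 \<noteq> 0" "\<zeta>1 \<noteq> 0" "\<zeta>2 \<noteq> 0"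
    using vals nz by auto
  have le1: "cmod (f w) \<le> 1" "cmod (g w) \<le> 1" if "w \<in> unit_disc" for w
    using f g that by (auto simp: image_subset_iff less_imp_le)
  obtain h1 where h1: "h1 holomorphic_on unit_disc" "\<And>w. w \<in> unit_disc \<Longrightarrow> cmod (h1 w) \<le> 1"
    and fh: "\<And>w. w \<in> unit_disc \<Longrightarrow> f w = blaschke \<zeta>0 w * blaschke \<zeta>2 w * h1 w"
    using blaschke_division2[OF f(1) le1(1), of \<zeta>0 \<zeta>2] in_disc vals ne by auto
  obtain h2 where h2: "h2 holomorphic_on unit_disc" "\<And>w. w \<in> unit_disc \<Longrightarrow> cmod (h2 w) \<le> 1"
    and gh: "\<And>w. w \<in> unit_disc \<Longrightarrow> g w = blaschke \<zeta>0 w * blaschke \<zeta>1 w * h2 w"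
    using blaschke_division2[OF g(1) le1(2), of \<zeta>0 \<zeta>1] in_disc vals ne by auto
  define \<alpha>1 where "\<alpha>1 = h1 0"
  define \<beta>1 where "\<beta>1 = h1 \<zeta>1"
  define \<alpha>2 where "\<alpha>2 = h2 0"
  define \<beta>2 where "\<beta>2 = h2 \<zeta>2"
  have z: "z1 = \<zeta>0 * \<zeta>2 * \<alpha>1" "z2 = \<zeta>0 * \<zeta>1 * \<alpha>2"
    using fh[of 0] gh[of 0] vals by (simp_all add: Moebius_function_of_zero \<alpha>1_def \<alpha>2_def)
  have e: "e1 = blaschke \<zeta>0 \<zeta>1 * blaschke \<zeta>2 \<zeta>1 * \<beta>1" "e2 = blaschke \<zeta>0 \<zeta>2 * blaschke \<zeta>1 \<zeta>2 * \<beta>2"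
    using fh[of \<zeta>1] gh[of \<zeta>2] vals in_disc by (simp_all add: \<beta>1_def \<beta>2_def)
  have nz': "\<alpha>1 \<noteq> 0" "\<alpha>2 \<noteq> 0" "\<beta>1 \<noteq> 0" "\<beta>2 \<noteq> 0" using z e nz by auto
  note z1_le = interpolating_disc_norm_le(1)[OF disc nz(3,4)]
  have z1_le0: "cmod z1 \<le> cmod \<zeta>0" using z1_le in_disc mult_left_mono[of "cmod \<zeta>2" 1 "cmod \<zeta>0"] by simp
  have z1_le2: "cmod z1 \<le> cmod \<zeta>2" using z1_le in_disc mult_right_mono[of "cmod \<zeta>0" 1 "cmod \<zeta>2"] by simp
  have z1_le\<alpha>: "cmod z1 \<le> cmod \<alpha>1"
  proof -
    have "cmod (\<zeta>0 * \<zeta>2) \<le> 1 * 1" unfolding norm_mult using in_disc by (intro mult_mono) auto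
    then have "cmod (\<zeta>0 * \<zeta>2) * cmod \<alpha>1 \<le> 1 * cmod \<alpha>1" by (intro mult_right_mono) auto
    then show ?thesis by (simp add: z norm_mult)
  qed

  have \<zeta>1_\<alpha>1: "cmod \<zeta>1 \<le> \<kappa> * cmod \<alpha>1"
  proof -
    have "cmod (\<zeta>0 * \<zeta>2) * cmod \<zeta>1 \<le> cmod (\<zeta>0 * \<zeta>2) * (\<kappa> * cmod \<alpha>1)"
      using P1 by (simp add: z norm_mult mult_ac)
    then show ?thesis using ne by simp
  qed
  have \<zeta>2_\<alpha>2: "cmod \<zeta>2 \<le> \<kappa> * cmod \<alpha>2"
  proof -
    have "cmod (\<zeta>0 * \<zeta>1) * cmod \<zeta>2 \<le> cmod (\<zeta>0 * \<zeta>1) * (\<kappa> * cmod \<alpha>2)"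
      using P2 by (simp add: z norm_mult mult_ac)
    then show ?thesis using ne by simp
  qed
  \<comment> \<open>The value of a bounded factor at its node agrees with its value at \<open>0\<close> up to a small relative error.\<close>
  have near_h: "cmod (\<beta> / \<alpha> - 1) \<le> 2 * \<kappa>"
    if "cmod (\<beta> - \<alpha>) \<le> 2 * cmod \<zeta>" "cmod \<zeta> \<le> \<kappa> * cmod \<alpha>" "\<alpha> \<noteq> 0" for \<alpha> \<beta> \<zeta> :: complex
  proof -
    have "\<beta> / \<alpha> - 1 = (\<beta> - \<alpha>) / \<alpha>" using that by (simp add: field_simps)
    then show ?thesis using that by (simp add: norm_divide divide_le_eq)
  qed
  have n1: "cmod (\<beta>1 / \<alpha>1 - 1) \<le> 2 * \<kappa>"
    using near_h[OF _ \<zeta>1_\<alpha>1 nz'(1), of \<beta>1] norm_diff_at_0_le[OF h1, of \<zeta>1] in_disc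
    by (simp add: \<alpha>1_def \<beta>1_def)
  have n2: "cmod (\<beta>2 / \<alpha>2 - 1) \<le> 2 * \<kappa>"
    using near_h[OF _ \<zeta>2_\<alpha>2 nz'(2), of \<beta>2] norm_diff_at_0_le[OF h2, of \<zeta>2] in_disc
    by (simp add: \<alpha>2_def \<beta>2_def)
  have n3: "cmod ((1 - \<zeta>1 / \<zeta>0) - 1) \<le> \<kappa>" "cmod ((1 - \<zeta>2 / \<zeta>0) - 1) \<le> \<kappa>"
    using \<zeta>1 \<zeta>2 ne by (auto simp: norm_divide divide_le_eq)
  have n4: "cmod ((1 - cnj a * b) - 1) \<le> \<kappa>" if "cmod a < 1" "cmod b \<le> \<kappa>" for a b
  proof -
    have "cmod a * cmod b \<le> 1 * \<kappa>" using that by (intro mult_mono) auto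
    then show ?thesis by (simp add: norm_mult)
  qed

  have far: "1/2 \<le> cmod x" if "cmod (x - 1) \<le> 2 * \<kappa>" for x
    using norm_triangle_ineq2[of 1 "1 - x"] that \<kappa> by (simp add: norm_minus_commute)
  have le2: "cmod x \<le> 2" if "cmod (x - 1) \<le> \<kappa>" for x
    using norm_triangle_ineq[of "x - 1" 1] that \<kappa> by simp
  have "cmod (\<zeta>1 / \<zeta>2 - 1) \<le> \<kappa>"
  proof -
    have b1: "cmod z1 / 2 \<le> cmod \<beta>1"
    proof -
      have "1/2 \<le> cmod (\<beta>1 / \<alpha>1)" by (rule far[OF n1])
      then show ?thesis using nz' z1_le\<alpha> by (simp add: norm_divide field_simps)
    qed
    have b2: "cmod z1 / 4 \<le> cmod (blaschke \<zeta>0 \<zeta>1)"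
    proof -
      have "1/2 \<le> cmod (1 - \<zeta>1 / \<zeta>0)" by (rule far) (use n3 \<kappa> in linarith)
      moreover have "1 - \<zeta>1 / \<zeta>0 = (\<zeta>0 - \<zeta>1) / \<zeta>0" using ne by (simp add: field_simps)
      ultimately have 1: "cmod \<zeta>0 / 2 \<le> cmod (\<zeta>1 - \<zeta>0)"
        using ne by (simp add: norm_divide field_simps norm_minus_commute)
      have "cmod (1 - cnj \<zeta>0 * \<zeta>1) \<le> 2" by (rule le2[OF n4]) (use in_disc \<zeta>1 in auto)
      then have "cmod (\<zeta>1 - \<zeta>0) / 2 \<le> cmod (blaschke \<zeta>0 \<zeta>1)"
        unfolding Moebius_function_simple norm_divide
        using one_minus_cnj_mult_nonzero[of \<zeta>0 \<zeta>1] in_disc by (intro divide_left_mono) auto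
      then show ?thesis using 1 z1_le0 by linarith
    qed
    have b3: "cmod (\<zeta>1 - \<zeta>2) / 2 \<le> cmod (blaschke \<zeta>2 \<zeta>1)"
    proof -
      have "cmod (1 - cnj \<zeta>2 * \<zeta>1) \<le> 2" by (rule le2[OF n4]) (use in_disc \<zeta>1 in auto)
      then show ?thesis
        unfolding Moebius_function_simple norm_divide
        using one_minus_cnj_mult_nonzero[of \<zeta>2 \<zeta>1] in_disc by (intro divide_left_mono) auto
    qed
    have "(cmod z1 / 4) * (cmod (\<zeta>1 - \<zeta>2) / 2) * (cmod z1 / 2) \<le> cmod e1"
      unfolding e(1) norm_mult using b1 b2 b3 by (intro mult_mono) auto
    also have "\<dots> \<le> \<kappa> * cmod z1 ^ 3 / 16" by (rule e1)
    finally have "(cmod z1)\<^sup>2 * cmod (\<zeta>1 - \<zeta>2) \<le> (cmod z1)\<^sup>2 * (\<kappa> * cmod z1)"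
      by (simp add: power2_eq_square power3_eq_cube mult_ac)
    then have "cmod (\<zeta>1 - \<zeta>2) \<le> \<kappa> * cmod z1" using nz by simp
    also have "\<dots> \<le> \<kappa> * cmod \<zeta>2" using z1_le2 \<kappa> by (intro mult_left_mono) auto
    finally have "cmod ((\<zeta>1 - \<zeta>2) / \<zeta>2) \<le> \<kappa>" using ne by (simp add: norm_divide divide_le_eq)
    moreover have "\<zeta>1 / \<zeta>2 - 1 = (\<zeta>1 - \<zeta>2) / \<zeta>2" using ne by (simp add: field_simps)
    ultimately show ?thesis by simp
  qed
  note n5 = this

  \<comment> \<open>The sign in \<open>prod\<close> below comes from \<open>\<zeta>1 - \<zeta>2\<close> against \<open>\<zeta>2 - \<zeta>1\<close> in the mixed Blaschke factors.\<close>
  define xs where "xs = [\<beta>1 / \<alpha>1, inverse (\<beta>2 / \<alpha>2), \<zeta>1 / \<zeta>2, 1 - \<zeta>1 / \<zeta>0, inverse (1 - \<zeta>2 / \<zeta>0),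
    1 - cnj \<zeta>0 * \<zeta>2, inverse (1 - cnj \<zeta>0 * \<zeta>1), 1 - cnj \<zeta>1 * \<zeta>2, inverse (1 - cnj \<zeta>2 * \<zeta>1)]"
  have near: "\<forall>x \<in> set xs. cmod (x - 1) \<le> 4 * \<kappa>"
  proof -
    have inv: "cmod (inverse a - 1) \<le> 4 * \<kappa>" if "cmod (a - 1) \<le> 2 * \<kappa>" for a
      using norm_inverse_minus_1_le[OF that] \<kappa> by simp
    have weaken: "cmod (a - 1) \<le> 2 * \<kappa>" if "cmod (a - 1) \<le> \<kappa>" for a
      using that \<kappa> by simp
    have weaken': "cmod (a - 1) \<le> 4 * \<kappa>" if "cmod (a - 1) \<le> 2 * \<kappa>" for a
      using that \<kappa> by simp
    have n6: "cmod ((1 - cnj \<zeta>0 * \<zeta>2) - 1) \<le> \<kappa>" "cmod ((1 - cnj \<zeta>0 * \<zeta>1) - 1) \<le> \<kappa>"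
      "cmod ((1 - cnj \<zeta>1 * \<zeta>2) - 1) \<le> \<kappa>" "cmod ((1 - cnj \<zeta>2 * \<zeta>1) - 1) \<le> \<kappa>"
      using n4 in_disc \<zeta>1 \<zeta>2 by blast+
    show ?thesis
      unfolding xs_def list.set ball_simps
      by (intro conjI TrueI inv weaken' n1 n2 n3[THEN weaken] n5[THEN weaken] n6[THEN weaken])
  qed
  have prod: "prod_list xs = - (e1 / e2 * (z2 / z1))"
  proof -
    have generic: "s1 / a * (m / b) * \<beta>1 / (s2 / c * (- m / d) * \<beta>2) * (\<zeta>0 * \<zeta>1 * \<alpha>2 / (\<zeta>0 * \<zeta>2 * \<alpha>1))
        = - (\<beta>1 / \<alpha>1 * inverse (\<beta>2 / \<alpha>2) * (\<zeta>1 / \<zeta>2) * (s1 / s2) * c * inverse a * d * inverse b)"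
      if "a \<noteq> 0" "b \<noteq> 0" "c \<noteq> 0" "d \<noteq> 0" "m \<noteq> 0" "s2 \<noteq> 0" for a b c d m s1 s2 :: complex
      using that nz' ne by (simp add: field_simps)
    have s: "(\<zeta>1 - \<zeta>0) / (\<zeta>2 - \<zeta>0) = (1 - \<zeta>1 / \<zeta>0) * inverse (1 - \<zeta>2 / \<zeta>0)"
    proof -
      have "1 - \<zeta>1 / \<zeta>0 = (\<zeta>0 - \<zeta>1) / \<zeta>0" "1 - \<zeta>2 / \<zeta>0 = (\<zeta>0 - \<zeta>2) / \<zeta>0"
        using ne by (auto simp: diff_divide_distrib)
      then have "(1 - \<zeta>1 / \<zeta>0) * inverse (1 - \<zeta>2 / \<zeta>0) = (\<zeta>0 - \<zeta>1) / (\<zeta>0 - \<zeta>2)"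
        using ne by simp
      then show ?thesis using minus_divide_divide[of "\<zeta>0 - \<zeta>1" "\<zeta>0 - \<zeta>2"] by (simp only: minus_diff_eq)
    qed
    have "e1 / e2 * (z2 / z1) = - (\<beta>1 / \<alpha>1 * inverse (\<beta>2 / \<alpha>2) * (\<zeta>1 / \<zeta>2) * ((\<zeta>1 - \<zeta>0) / (\<zeta>2 - \<zeta>0)) *
       (1 - cnj \<zeta>0 * \<zeta>2) * inverse (1 - cnj \<zeta>0 * \<zeta>1) * (1 - cnj \<zeta>1 * \<zeta>2) * inverse (1 - cnj \<zeta>2 * \<zeta>1))"
      unfolding e z Moebius_function_simple
      using generic[of "1 - cnj \<zeta>0 * \<zeta>1" "1 - cnj \<zeta>2 * \<zeta>1" "1 - cnj \<zeta>0 * \<zeta>2" "1 - cnj \<zeta>1 * \<zeta>2"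
          "\<zeta>1 - \<zeta>2" "\<zeta>2 - \<zeta>0" "\<zeta>1 - \<zeta>0"] in_disc ne one_minus_cnj_mult_nonzero
      by simp
    then show ?thesis unfolding s xs_def by (simp add: mult_ac)
  qed
  have "cmod (prod_list xs - 1) \<le> 2 * (4 * \<kappa>) * length xs"
    using near \<kappa> by (intro norm_prod_list_minus_1_le) (auto simp: xs_def)
  then have "cmod (prod_list xs - 1) \<le> 72 * \<kappa>" by (simp add: xs_def)
  moreover have "prod_list xs - 1 = - (e1 / e2 * (z2 / z1) + 1)" unfolding prod by simp
  ultimately show ?thesis by (metis norm_minus_cancel)
qed


lemma sgn_divide_eq_unit_product:
  fixes a b :: complex
  shows "a / of_real (cmod a) * (of_real (cmod b) / b) = sgn (a / b)"
  by (simp add: sgn_eq norm_divide)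

lemma norm_sgn_quotient_add_1:
  fixes p q :: complex
  assumes "q \<noteq> 0"
  shows "cmod (sgn (p / q) + 1) = cmod (sgn q + sgn p)"
proof -
  have "sgn q \<noteq> 0" using assms by (simp add: sgn_zero_iff)
  then have "sgn (p / q) + 1 = (sgn q + sgn p) / sgn q"
    by (simp add: sgn_divide add_divide_distrib)
  then show ?thesis using assms by (simp add: norm_divide norm_sgn)
qed

text \<open>A disc with \<open>\<bar>\<zeta>0 \<zeta>1 \<zeta>2\<bar>\<close> far below \<open>\<bar>z\<bar>\<^bsup>3/2\<^esup>\<close> has \<open>\<bar>\<zeta>1\<bar>, \<bar>\<zeta>2\<bar>\<close> far below \<open>\<bar>z\<bar>\<^bsup>1/2\<^esup>\<close>, because
  \<open>\<bar>\<zeta>0 \<zeta>2\<bar>\<close> and \<open>\<bar>\<zeta>0 \<zeta>1\<bar>\<close> are at least of the order of \<open>\<bar>z\<bar>\<close>; for the same reason \<open>\<bar>\<zeta>0\<bar>\<close> is then far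
  above \<open>\<bar>z\<bar>\<^bsup>1/2\<^esup>\<close>. So \<open>ratio_near_minus_1\<close> applies and places \<open>e1 / e2\<close> near \<open>- (z1 / z2)\<close>, which
  the assumption on the arguments excludes. The factor \<open>1/1000\<close> is chosen to have \<open>2 \<cdot> 72 / 1000 < 1\<close>.\<close>

lemma lempert_bidisc_ge:
  assumes c0: "0 < c0" "c0 \<le> 1"
    and z: "cmod z1 < 1" "cmod z2 < 1" "z1 \<noteq> 0" "z2 \<noteq> 0"
    and ratio: "c0 * cmod z2 \<le> cmod z1" "c0 * cmod z1 \<le> cmod z2"
    and e: "e1 \<noteq> 0" "e2 \<noteq> 0" "cmod e1 \<le> c0 / 1000 * cmod z1 ^ 3 / 16"
    and angle: "c0 \<le> cmod (sgn (z1 / z2) + sgn (e1 / e2))"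
  shows "elog (c0 ^ 3 / 1000 * sqrt (max (cmod z1) (cmod z2)) ^ 3)
    \<le> lempert_bidisc (vector [e1, e2]) (vector [z1, z2])"
  unfolding lempert_bidisc_eq_Inf
proof (rule Inf_greatest, clarify)
  fix \<zeta>0 \<zeta>1 \<zeta>2 f g
  assume disc: "interpolating_disc e1 e2 z1 z2 \<zeta>0 \<zeta>1 \<zeta>2 f g"
  define \<kappa> where "\<kappa> = c0 / 1000"
  have \<kappa>: "0 < \<kappa>" "\<kappa> \<le> 1/72" "\<kappa> \<le> 1" using c0 by (auto simp: \<kappa>_def)
  define r where "r = max (cmod z1) (cmod z2)"
  define s where "s = sqrt r"
  have r: "0 < r" "r < 1" using z by (auto simp: r_def less_max_iff_disj)
  have s: "0 < s" "s \<le> 1" "s * s = r" using r by (auto simp: s_def)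
  have large: "c0 * (s * s) \<le> cmod z1" "c0 * (s * s) \<le> cmod z2"
  proof -
    have "c0 * cmod z1 \<le> 1 * cmod z1" "c0 * cmod z2 \<le> 1 * cmod z2"
      using c0 by (intro mult_right_mono; simp)+
    then show "c0 * (s * s) \<le> cmod z1" "c0 * (s * s) \<le> cmod z2"
      unfolding s(3) r_def using ratio by (auto simp: max_def)
  qed
  note norms = interpolating_disc_norm_le[OF disc e(1,2)]
  have pos: "0 < cmod z1" "0 < cmod z2" using z by auto
  have nz: "\<zeta>1 \<noteq> 0" "\<zeta>2 \<noteq> 0" using norms pos by auto
  have "\<kappa> * c0\<^sup>2 * s ^ 3 \<le> cmod (\<zeta>0 * \<zeta>1 * \<zeta>2)"
  proof (rule ccontr)
    assume "\<not> ?thesis"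
    then have small: "cmod \<zeta>0 * cmod \<zeta>1 * cmod \<zeta>2 \<le> \<kappa> * c0 * s * (c0 * (s * s))"
      by (simp add: norm_mult power2_eq_square power3_eq_cube mult_ac)
    have small': "cmod \<zeta>0 * cmod \<zeta>1 * cmod \<zeta>2 \<le> \<kappa> * c0 * s * t" if "c0 * (s * s) \<le> t" for t
      by (rule order_trans[OF small mult_left_mono[OF that]]) (use \<kappa> c0 s(1) in simp)
    have c0s: "c0 * s \<le> 1" using mult_mono[of c0 1 s 1] c0 s by simp
    have \<kappa>cs: "\<kappa> * c0 * s \<le> \<kappa>" using mult_left_mono[OF c0s, of \<kappa>] \<kappa> by simp
    have P: "cmod (\<zeta>0 * \<zeta>1 * \<zeta>2) \<le> \<kappa> * t" if "c0 * (s * s) \<le> t" "0 < t" for t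
      using small'[OF that(1)] mult_right_mono[OF \<kappa>cs, of t] that by (simp add: norm_mult)
    have "cmod \<zeta>1 * cmod z1 \<le> cmod \<zeta>1 * (cmod \<zeta>0 * cmod \<zeta>2)"
      using norms by (intro mult_left_mono) auto
    also have "\<dots> \<le> \<kappa> * c0 * s * cmod z1" using small'[OF large(1)] by (simp add: mult_ac)
    finally have \<zeta>1: "cmod \<zeta>1 \<le> \<kappa> * c0 * s" using pos by simp
    have "cmod \<zeta>2 * cmod z2 \<le> cmod \<zeta>2 * (cmod \<zeta>0 * cmod \<zeta>1)"
      using norms by (intro mult_left_mono) auto
    also have "\<dots> \<le> \<kappa> * c0 * s * cmod z2" using small'[OF large(2)] by (simp add: mult_ac)
    finally have \<zeta>2: "cmod \<zeta>2 \<le> \<kappa> * c0 * s" using pos by simp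
    have "cmod \<zeta>1 * cmod \<zeta>2 \<le> (\<kappa> * c0 * s) * (\<kappa> * c0 * s)"
      using \<zeta>1 \<zeta>2 \<kappa> c0 s by (intro mult_mono) auto
    also have "\<dots> = \<kappa> * ((\<kappa> * c0) * (c0 * (s * s)))" by (simp only: mult_ac)
    also have "\<dots> \<le> \<kappa> * (1 * (c0 * (s * s)))"
    proof -
      have "\<kappa> * c0 \<le> 1" using mult_mono[of \<kappa> 1 c0 1] \<kappa> c0 by simp
      then show ?thesis using \<kappa> c0 s by (intro mult_left_mono mult_right_mono) auto
    qed
    finally have \<zeta>12: "cmod \<zeta>1 * cmod \<zeta>2 \<le> \<kappa> * (c0 * (s * s))" unfolding mult_1 .
    have "cmod \<zeta>1 * cmod \<zeta>2 \<le> \<kappa> * (cmod \<zeta>0 * cmod \<zeta>2)"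
      by (rule order_trans[OF \<zeta>12 mult_left_mono[OF order_trans[OF large(1) norms(1)]]]) (use \<kappa> in simp)
    then have \<zeta>10: "cmod \<zeta>1 \<le> \<kappa> * cmod \<zeta>0" using nz by (simp flip: mult.assoc)
    have "cmod \<zeta>1 * cmod \<zeta>2 \<le> \<kappa> * (cmod \<zeta>0 * cmod \<zeta>1)"
      by (rule order_trans[OF \<zeta>12 mult_left_mono[OF order_trans[OF large(2) norms(2)]]]) (use \<kappa> in simp)
    then have "cmod \<zeta>2 * cmod \<zeta>1 \<le> \<kappa> * cmod \<zeta>0 * cmod \<zeta>1" by (simp add: mult_ac)
    then have \<zeta>20: "cmod \<zeta>2 \<le> \<kappa> * cmod \<zeta>0" using nz by simp
    have "cmod (e1 / e2 * (z2 / z1) + 1) \<le> 72 * \<kappa>"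
    proof (rule ratio_near_minus_1[OF disc z(3,4) e(1,2) \<kappa>(1,2)])
      show "cmod e1 \<le> \<kappa> * cmod z1 ^ 3 / 16" using e(3) by (simp add: \<kappa>_def)
      show "cmod \<zeta>1 \<le> \<kappa>" "cmod \<zeta>2 \<le> \<kappa>" using \<zeta>1 \<zeta>2 \<kappa>cs by linarith+
    qed (fact \<zeta>10 \<zeta>20 P[OF large(1) pos(1)] P[OF large(2) pos(2)])+
    then have "cmod (e1 / e2 / (z1 / z2) + 1) \<le> 72 * \<kappa>" by simp
    then have "cmod (sgn (z1 / z2) + sgn (e1 / e2)) \<le> 2 * (72 * \<kappa>)"
      using norm_sgn_add_1_le(1)[of "e1 / e2 / (z1 / z2)"] norm_sgn_quotient_add_1[of "z1 / z2" "e1 / e2"] z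
      by simp
    then show False using angle c0 by (simp add: \<kappa>_def)
  qed
  then show "elog (c0 ^ 3 / 1000 * sqrt (max (cmod z1) (cmod z2)) ^ 3) \<le> elog (cmod (\<zeta>0 * \<zeta>1 * \<zeta>2))"
    using c0 r by (intro elog_mono) (auto simp: \<kappa>_def s_def r_def power2_eq_square power3_eq_cube)
qed

section \<open>Behaviour as the poles merge\<close>

lemma elog_mult_square:
  assumes "0 \<le> r" "0 < c"
  shows "elog (c * r\<^sup>2) = 2 * elog r + ereal (ln c)"
  using assms by (cases "r = 0") (auto simp: elog_def ln_mult ln_realpow)

lemma elog_mult_sqrt_cube:
  assumes "0 < r" "0 < c"
  shows "elog (c * sqrt r ^ 3) = ereal (3 / 2) * elog r + ereal (ln c)"
  using assms by (simp add: elog_def ln_mult ln_realpow ln_sqrt)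

lemma pr_tendsto_0: "(pr1 \<longlongrightarrow> 0) (at 0 within E)" "(pr2 \<longlongrightarrow> 0) (at 0 within E)"
  using tendsto_vec_nth[OF tendsto_ident_at, of _ 0 E] by auto

lemma eventually_mem: "\<forall>\<^sub>F \<epsilon> in at 0 within E. \<epsilon> \<in> E"
  for E :: "(complex ^ 2) set"
  by (simp add: eventually_at_filter)

lemma eventually_pr_nonzero:
  assumes "E \<subseteq> punctured_disc_sq"
  shows "\<forall>\<^sub>F \<epsilon> in at 0 within E. pr1 \<epsilon> \<noteq> 0 \<and> pr2 \<epsilon> \<noteq> 0"
  using eventually_mem[of E] by eventually_elim (use assms in \<open>auto simp: punctured_disc_sq_def\<close>)

lemma lempert_bidisc_components:
  "lempert_bidisc \<epsilon> z = lempert_bidisc (vector [pr1 \<epsilon>, pr2 \<epsilon>]) (vector [pr1 z, pr2 z])"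
  by (simp add: vector_2_components)

lemma Limsup_lempert_bidisc_degenerate:
  assumes z: "z \<in> bidisc" and E: "E \<subseteq> punctured_disc_sq"
    and cases: "pr1 z = 0 \<or> pr2 z = 0 \<or>
      (pr1 z \<noteq> 0 \<and> pr2 z \<noteq> 0 \<and>
       ((\<lambda>\<epsilon>. pr1 \<epsilon> / pr2 \<epsilon>) \<longlongrightarrow> - (pr1 z / pr2 z)) (at 0 within E))"
  shows "Limsup (at 0 within E) (\<lambda>\<epsilon>. lempert_bidisc \<epsilon> z) \<le> 2 * elog (max_norm z) + ereal (ln 8)"
proof -
  have zn: "cmod (pr1 z) < 1" "cmod (pr2 z) < 1" using z by (auto simp: bidisc_def)
  have nz: "\<forall>\<^sub>F \<epsilon> in at 0 within E. pr1 \<epsilon> \<noteq> 0" "\<forall>\<^sub>F \<epsilon> in at 0 within E. pr2 \<epsilon> \<noteq> 0"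
    using eventually_pr_nonzero[OF E] by (auto elim: eventually_mono)
  have "Limsup (at 0 within E) (\<lambda>\<epsilon>. lempert_bidisc (vector [pr1 \<epsilon>, pr2 \<epsilon>]) (vector [pr1 z, pr2 z]))
      \<le> elog (8 * (max_norm z)\<^sup>2)"
    using cases
  proof (elim disjE conjE)
    assume "pr1 z = 0"
    then show ?thesis
      using Limsup_lempert_bidisc_axis[OF pr_tendsto_0(2,1) nz(2) zn(2)]
      unfolding lempert_bidisc_swap[of "pr2 e" "pr1 e" for e] by (simp add: max_norm_def)
  next
    assume "pr2 z = 0"
    then show ?thesis
      using Limsup_lempert_bidisc_axis[OF pr_tendsto_0 nz(1) zn(1)] by (simp add: max_norm_def)
  next
    assume "pr1 z \<noteq> 0" "pr2 z \<noteq> 0"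
      "((\<lambda>\<epsilon>. pr1 \<epsilon> / pr2 \<epsilon>) \<longlongrightarrow> - (pr1 z / pr2 z)) (at 0 within E)"
    from Limsup_lempert_bidisc_tangent[OF pr_tendsto_0(1) nz(1) zn this]
    show ?thesis by (simp add: max_norm_def)
  qed
  also have "elog (8 * (max_norm z)\<^sup>2) = 2 * elog (max_norm z) + ereal (ln 8)"
    by (rule elog_mult_square) (auto simp: max_norm_def le_max_iff_disj)
  finally show ?thesis unfolding lempert_bidisc_components[of _ z] .
qed

text \<open>The hypotheses on the ratio force \<open>c0 \<le> 1\<close>. For the upper bound, the assumption on the arguments is
  turned into transversality with the constant \<open>c0 / 2\<close>.\<close>

lemma lempert_bidisc_generic_bounds:
  assumes c0: "0 < c0" and z: "z \<in> bidisc" and E: "E \<subseteq> punctured_disc_sq" and z0: "pr1 z \<noteq> 0" "pr2 z \<noteq> 0"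
    and ratio: "c0 \<le> cmod (pr1 z / pr2 z)" "cmod (pr1 z / pr2 z) \<le> inverse c0"
    and angle: "\<forall>\<epsilon>\<in>E. c0 \<le> cmod (sgn (pr1 z / pr2 z) + sgn (pr1 \<epsilon> / pr2 \<epsilon>))"
    and C: "\<bar>ln (c0 ^ 3 / 1000)\<bar> \<le> C" "ln (sqrt 2 ^ 3) \<le> C"
  shows "Liminf (at 0 within E) (\<lambda>\<epsilon>. lempert_bidisc \<epsilon> z) \<ge> ereal (3 / 2) * elog (max_norm z) - ereal C" (is ?lower)
    and "Limsup (at 0 within E) (\<lambda>\<epsilon>. lempert_bidisc \<epsilon> z) \<le> ereal (3 / 2) * elog (max_norm z) + ereal C" (is ?upper)
proof -
  have zn: "cmod (pr1 z) < 1" "cmod (pr2 z) < 1" using z by (auto simp: bidisc_def)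
  have r: "0 < max_norm z" using z0 by (simp add: max_norm_def less_max_iff_disj)
  have "c0 \<le> inverse c0" using ratio by linarith
  then have "c0 * c0 \<le> 1 * 1" using c0 by (simp add: field_simps)
  then have c0_le: "c0 \<le> 1" using c0 by (metis mult_strict_mono' not_le less_imp_le zero_le_one)
  have ratio': "c0 * cmod (pr2 z) \<le> cmod (pr1 z)" "c0 * cmod (pr1 z) \<le> cmod (pr2 z)"
    using ratio c0 z0 by (simp_all add: norm_divide field_simps)
  show ?lower
  proof (rule Liminf_bounded)
    have "0 < c0 / 1000 * cmod (pr1 z) ^ 3 / 16" using c0 z0 by simp
    then have "\<forall>\<^sub>F \<epsilon> in at 0 within E. cmod (pr1 \<epsilon>) < c0 / 1000 * cmod (pr1 z) ^ 3 / 16"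
      by (rule order_tendstoD(2)[OF tendsto_norm_zero[OF pr_tendsto_0(1)]])
    then show "\<forall>\<^sub>F \<epsilon> in at 0 within E. ereal (3 / 2) * elog (max_norm z) - ereal C \<le> lempert_bidisc \<epsilon> z"
      using eventually_mem eventually_pr_nonzero[OF E]
    proof eventually_elim
      case (elim \<epsilon>)
      have "ereal (3 / 2) * elog (max_norm z) - ereal C
          \<le> ereal (3 / 2) * elog (max_norm z) + ereal (ln (c0 ^ 3 / 1000))"
        using r C by (simp add: elog_def)
      also have "\<dots> = elog (c0 ^ 3 / 1000 * sqrt (max_norm z) ^ 3)"
        by (rule elog_mult_sqrt_cube[symmetric]) (use r c0 in auto)
      also have "\<dots> \<le> lempert_bidisc \<epsilon> z"
        unfolding lempert_bidisc_components[of _ z] max_norm_def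
        by (rule lempert_bidisc_ge) (use c0 c0_le zn z0 ratio' elim angle in auto)
      finally show ?case .
    qed
  qed
  have "Limsup (at 0 within E) (\<lambda>\<epsilon>. lempert_bidisc \<epsilon> z) \<le> elog (sqrt (2 * max_norm z) ^ 3)"
    unfolding lempert_bidisc_components[of _ z] max_norm_def
  proof (rule Limsup_lempert_bidisc_transversal[OF pr_tendsto_0 eventually_pr_nonzero[OF E] zn z0])
    show "0 < c0 / 2" using c0 by simp
    show "\<forall>\<^sub>F \<epsilon> in at 0 within E. c0 / 2 * max 1 (cmod (pr1 \<epsilon> / pr2 \<epsilon> * (pr2 z / pr1 z)))
        \<le> cmod (1 + pr1 \<epsilon> / pr2 \<epsilon> * (pr2 z / pr1 z))"
      using eventually_mem
    proof eventually_elim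
      case (elim \<epsilon>)
      define \<rho> where "\<rho> = pr1 \<epsilon> / pr2 \<epsilon> / (pr1 z / pr2 z)"
      have \<rho>: "c0 \<le> cmod (sgn \<rho> + 1)"
        unfolding \<rho>_def using angle elim z0 by (subst norm_sgn_quotient_add_1) auto
      moreover have "cmod \<rho> * c0 \<le> cmod \<rho> * cmod (sgn \<rho> + 1)"
        using \<rho> by (intro mult_left_mono) auto
      ultimately have "c0 / 2 * max 1 (cmod \<rho>) \<le> cmod (1 + \<rho>)"
        using norm_sgn_add_1_le[of \<rho>] by (simp add: max_def add.commute mult_ac)
      then show ?case by (simp add: \<rho>_def)
    qed
  qed
  also have "sqrt (2 * max_norm z) ^ 3 = sqrt 2 ^ 3 * sqrt (max_norm z) ^ 3"
    by (simp add: real_sqrt_mult power_mult_distrib)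
  also have "elog \<dots> = ereal (3 / 2) * elog (max_norm z) + ereal (ln (sqrt 2 ^ 3))"
    by (rule elog_mult_sqrt_cube) (use r in auto)
  also have "\<dots> \<le> ereal (3 / 2) * elog (max_norm z) + ereal C"
    by (intro add_left_mono) (use C in simp)
  finally show ?upper .
qed

theorem theorem1p3:
  shows
    "(\<exists>C::real. C > 0 \<and>
       (\<forall>z \<in> bidisc. \<forall>E. E \<subseteq> punctured_disc_sq \<longrightarrow> 0 islimpt E \<longrightarrow>
          (pr1 z = 0 \<or> pr2 z = 0 \<or>
           (pr1 z \<noteq> 0 \<and> pr2 z \<noteq> 0 \<and>
            ((\<lambda>\<epsilon>. pr1 \<epsilon> / pr2 \<epsilon>) \<longlongrightarrow> - (pr1 z / pr2 z)) (at 0 within E))) \<longrightarrow>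
          Limsup (at 0 within E) (\<lambda>\<epsilon>. lempert_bidisc \<epsilon> z)
            \<le> 2 * elog (max_norm z) + ereal C))
     \<and>
     (\<forall>c0::real. c0 > 0 \<longrightarrow>
       (\<exists>C::real. C > 0 \<and>
         (\<forall>z \<in> bidisc. \<forall>E. E \<subseteq> punctured_disc_sq \<longrightarrow> 0 islimpt E \<longrightarrow>
            pr1 z \<noteq> 0 \<longrightarrow> pr2 z \<noteq> 0 \<longrightarrow>
            c0 \<le> cmod (pr1 z / pr2 z) \<longrightarrow> cmod (pr1 z / pr2 z) \<le> inverse c0 \<longrightarrow>
            (\<forall>\<epsilon> \<in> E.
               cmod (pr1 z / of_real (cmod (pr1 z)) * (of_real (cmod (pr2 z)) / pr2 z)
                     + pr1 \<epsilon> / of_real (cmod (pr1 \<epsilon>)) * (of_real (cmod (pr2 \<epsilon>)) / pr2 \<epsilon>))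
               \<ge> c0) \<longrightarrow>
            Liminf (at 0 within E) (\<lambda>\<epsilon>. lempert_bidisc \<epsilon> z)
              \<ge> ereal (3 / 2) * elog (max_norm z) - ereal C
            \<and>
            (((\<lambda>\<epsilon>. (pr1 \<epsilon>)\<^sup>2 / pr2 \<epsilon>) \<longlongrightarrow> 0) (at 0 within E) \<longrightarrow>
             ((\<lambda>\<epsilon>. (pr2 \<epsilon>)\<^sup>2 / pr1 \<epsilon>) \<longlongrightarrow> 0) (at 0 within E) \<longrightarrow>
             Limsup (at 0 within E) (\<lambda>\<epsilon>. lempert_bidisc \<epsilon> z)
               \<le> ereal (3 / 2) * elog (max_norm z) + ereal C))))"
proof (rule conjI, goal_cases)
  case 1
  have "ln 8 > (0::real)" by simp
  then show ?case
    using Limsup_lempert_bidisc_degenerate by (intro exI[of _ "ln 8"] conjI ballI allI impI)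
next
  case 2
  show ?case
    unfolding sgn_divide_eq_unit_product
  proof (intro allI impI)
    fix c0 :: real assume c0: "c0 > 0"
    define C where "C = \<bar>ln (c0 ^ 3 / 1000)\<bar> + ln (sqrt 2 ^ 3)"
    have "ln (sqrt 2 ^ 3) > (0::real)" by (intro ln_gt_zero one_less_power) auto
    then have "C > 0" and C: "\<bar>ln (c0 ^ 3 / 1000)\<bar> \<le> C" "ln (sqrt 2 ^ 3) \<le> C"
      unfolding C_def by linarith+
    note bounds = lempert_bidisc_generic_bounds[OF c0 _ _ _ _ _ _ _ C]
    show "\<exists>C>0. \<forall>z\<in>bidisc. \<forall>E. E \<subseteq> punctured_disc_sq \<longrightarrow> 0 islimpt E \<longrightarrow>
        pr1 z \<noteq> 0 \<longrightarrow> pr2 z \<noteq> 0 \<longrightarrow>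
        c0 \<le> cmod (pr1 z / pr2 z) \<longrightarrow> cmod (pr1 z / pr2 z) \<le> inverse c0 \<longrightarrow>
        (\<forall>\<epsilon>\<in>E. c0 \<le> cmod (sgn (pr1 z / pr2 z) + sgn (pr1 \<epsilon> / pr2 \<epsilon>))) \<longrightarrow>
        ereal (3 / 2) * elog (max_norm z) - ereal C \<le> Liminf (at 0 within E) (\<lambda>\<epsilon>. lempert_bidisc \<epsilon> z) \<and>
        (((\<lambda>\<epsilon>. (pr1 \<epsilon>)\<^sup>2 / pr2 \<epsilon>) \<longlongrightarrow> 0) (at 0 within E) \<longrightarrow>
         ((\<lambda>\<epsilon>. (pr2 \<epsilon>)\<^sup>2 / pr1 \<epsilon>) \<longlongrightarrow> 0) (at 0 within E) \<longrightarrow>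
         Limsup (at 0 within E) (\<lambda>\<epsilon>. lempert_bidisc \<epsilon> z) \<le> ereal (3 / 2) * elog (max_norm z) + ereal C)"
    proof (intro exI[of _ C] conjI ballI allI impI)
      show "C > 0" by fact
    qed (rule bounds; assumption)+
  qed
qed

end
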